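(* Let $K$ be a field of characteristic zero which is algebraically closed in a field $L\supseteq K$, let $x=(x_1,\dots,x_n)$ and $H\in L[x]^m$ with $\operatorname{trdeg}_K K(H)\le\operatorname{trdeg}_L L(H)$. Let $\tilde L$ be an extension field of $L$ and let $p\in\tilde L^m$ be a projective image apex of $H$ over $K$. Write $p=\lambda_1p^{(1)}+\cdots+\lambda_rp^{(r)}$ with $p^{(i)}\in K^m$ and $\lambda_1,\dots,\lambda_r\in\tilde L$ linearly independent over $K$. Then for each $i$, $p^{(i)}$ is either zero or a projective image apex of $H$ over $\tilde L$.
   Context: With $y=(y_1,\dots,y_m)$, a new indeterminate $t$ and a field $F\supseteq K$: a vector $p$ with entries in an extension field of $L$ containing $F$ is a projective image apex of $H$ over $F$ if $p\ne0$ and for every $f\in F[y]$, $f(H)=0$ implies $f(H+tp)=0$. $F(H)$ is the field generated over $F$ by the components of $H$, $\operatorname{trdeg}$ its transcendence degree. *)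

theory Defs
  imports "HOL-Library.Poly_Mapping" "HOL-Computational_Algebra.Polynomial"
begin

text \<open>All fields are subfields of one ambient field of characteristic zero.\<close>

definition is_subfield :: "'a::field set \<Rightarrow> bool" where
  "is_subfield S \<longleftrightarrow> 0 \<in> S \<and> 1 \<in> S \<and>
     (\<forall>a\<in>S. \<forall>b\<in>S. a + b \<in> S \<and> a * b \<in> S) \<and>
     (\<forall>a\<in>S. - a \<in> S \<and> inverse a \<in> S)"

definition algebraic_over :: "'a::field set \<Rightarrow> 'a \<Rightarrow> bool" where
  "algebraic_over F a \<longleftrightarrow> (\<exists>q::'a poly. q \<noteq> 0 \<and> (\<forall>i. coeff q i \<in> F) \<and> poly q a = 0)"

definition alg_closed_in :: "'a::field set \<Rightarrow> 'a set \<Rightarrow> bool" where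
  "alg_closed_in F E \<longleftrightarrow> (\<forall>a\<in>E. algebraic_over F a \<longrightarrow> a \<in> F)"

type_synonym 'a mpoly = "(nat \<Rightarrow>\<^sub>0 nat) \<Rightarrow>\<^sub>0 'a"

definition mp_coeffs_in :: "'a::zero set \<Rightarrow> 'a mpoly \<Rightarrow> bool" where
  "mp_coeffs_in F f \<longleftrightarrow> (\<forall>\<alpha>. Poly_Mapping.lookup f \<alpha> \<in> F)"

definition mp_vars_in :: "nat set \<Rightarrow> 'a::zero mpoly \<Rightarrow> bool" where
  "mp_vars_in V f \<longleftrightarrow> (\<forall>\<alpha>\<in>Poly_Mapping.keys f. Poly_Mapping.keys \<alpha> \<subseteq> V)"

definition mp_Var :: "nat \<Rightarrow> 'a::{zero,one} mpoly" where
  "mp_Var i = Poly_Mapping.single (Poly_Mapping.single i 1) 1"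

definition mp_Const :: "'a::zero \<Rightarrow> 'a mpoly" where
  "mp_Const c = Poly_Mapping.single 0 c"

definition mp_subst :: "'a::comm_ring_1 mpoly \<Rightarrow> (nat \<Rightarrow> 'a mpoly) \<Rightarrow> 'a mpoly" where
  "mp_subst f G = (\<Sum>\<alpha>\<in>Poly_Mapping.keys f. mp_Const (Poly_Mapping.lookup f \<alpha>) * (\<Prod>j\<in>Poly_Mapping.keys \<alpha>. G j ^ Poly_Mapping.lookup \<alpha> j))"

definition alg_indep :: "'a::comm_ring_1 set \<Rightarrow> (nat \<Rightarrow> 'a mpoly) \<Rightarrow> nat set \<Rightarrow> bool" where
  "alg_indep F H S \<longleftrightarrow>
     (\<forall>f. mp_coeffs_in F f \<and> mp_vars_in S f \<and> mp_subst f H = 0 \<longrightarrow> f = 0)"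

text \<open>trdeg_F F(H): transcendence degree of the field generated over F by H 0,...,H (m-1),
  i.e. the maximal number of algebraically independent components.\<close>
definition trdeg :: "'a::comm_ring_1 set \<Rightarrow> (nat \<Rightarrow> 'a mpoly) \<Rightarrow> nat \<Rightarrow> nat" where
  "trdeg F H m = Max {card S | S. S \<subseteq> {..<m} \<and> alg_indep F H S}"

text \<open>p (entries p 0,...,p (m-1)) is a projective image apex of H over F, where H is in
  variables x_0,...,x_(n-1) and the new indeterminate t is the variable x_n.\<close>
definition proj_image_apex ::
  "'a::comm_ring_1 set \<Rightarrow> nat \<Rightarrow> nat \<Rightarrow> (nat \<Rightarrow> 'a mpoly) \<Rightarrow> (nat \<Rightarrow> 'a) \<Rightarrow> bool" where
  "proj_image_apex F n m H p \<longleftrightarrow>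
     (\<exists>j<m. p j \<noteq> 0) \<and>
     (\<forall>f. mp_coeffs_in F f \<and> mp_vars_in {..<m} f \<and> mp_subst f H = 0 \<longrightarrow>
          mp_subst f (\<lambda>j. H j + mp_Const (p j) * mp_Var n) = 0)"

end

theory Submission
  imports Defs
begin

text \<open>
  Let $I_F$ be the ideal of relations of $H$ over $F$. The heart of the matter is that $K[H]$ is
  linearly disjoint over $K$ from every extension of $L$. Suppose
  $\<lambda>_1 g_1(H) + \<dots> + \<lambda>_s g_s(H) = 0$ with the $\<lambda>_i$ linearly independent over $K$, the
  $g_i$ over $K$ and $g_1(H) \<noteq> 0$. For a copy $H'$ of $H$ in fresh variables, the elements
  $g_i(H) g_1(H') - g_1(H) g_i(H')$ with $i \<ge> 2$ satisfy the same relation, so by induction on $s$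
  they vanish. Hence $g_i(H) = k_i g_1(H)$ with $k_i \<in> L \<inter> K(H)$. By the hypothesis on the
  transcendence degrees, some components $H_S$ form a transcendence basis of $K(H)$ over $K$ and are
  independent over $L$; so $k_i$ is algebraic over $K(H_S)$, hence over $K$, and lies in $K$. This
  contradicts the independence of the $\<lambda>_i$. The pair $(H, H')$ inherits the hypotheses on $H$.

  Let $D_v$ be the derivative in direction $v$. For $f \<in> I_K$ the linear coefficient of
  $f(H + tp) = 0$ gives $\<Sum>_i \<lambda>_i (D_{p^{(i)}} f)(H) = 0$, so disjointness yields
  $D_{p^{(i)}} f \<in> I_K$. Since the characteristic is zero, iterating this kills all the Taylor
  coefficients of $f(H + tp^{(i)})$. By disjointness again, $I_K$ generates the relations over any
  larger field.
\<close>

section \<open>Evaluation of polynomials\<close>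

lemma poly_mapping_sum_singles:
  "f = (\<Sum>\<alpha>\<in>Poly_Mapping.keys f. Poly_Mapping.single \<alpha> (Poly_Mapping.lookup f \<alpha>))"
proof (rule poly_mapping_eqI)
  fix k
  show "Poly_Mapping.lookup f k = Poly_Mapping.lookup
      (\<Sum>\<alpha>\<in>Poly_Mapping.keys f. Poly_Mapping.single \<alpha> (Poly_Mapping.lookup f \<alpha>)) k"
    by (simp add: lookup_sum lookup_single when_def in_keys_iff)
qed

lemma poly_mapping_additive_induct:
  fixes f :: "'k \<Rightarrow>\<^sub>0 'b::comm_monoid_add"
  assumes single: "\<And>k v. P (Poly_Mapping.single k v)"
    and add: "\<And>f g. P f \<Longrightarrow> P g \<Longrightarrow> P (f + g)"
  shows "P f"
proof -
  have zero: "P 0"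
    using single[of _ 0] by simp
  have "P (\<Sum>k\<in>A. Poly_Mapping.single k (Poly_Mapping.lookup f k))" if "finite A" for A
    using that by (induction A rule: finite_induct) (simp_all add: single add zero)
  then show ?thesis
    by (subst poly_mapping_sum_singles) simp
qed

definition mp_monom :: "(nat \<Rightarrow> 'b::comm_monoid_mult) \<Rightarrow> (nat \<Rightarrow>\<^sub>0 nat) \<Rightarrow> 'b" where
  "mp_monom G \<alpha> = (\<Prod>j\<in>Poly_Mapping.keys \<alpha>. G j ^ Poly_Mapping.lookup \<alpha> j)"

lemma mp_monom_superset:
  assumes "finite A" "Poly_Mapping.keys \<alpha> \<subseteq> A"
  shows "mp_monom G \<alpha> = (\<Prod>j\<in>A. G j ^ Poly_Mapping.lookup \<alpha> j)"
  unfolding mp_monom_def using assms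
  by (intro prod.mono_neutral_left) (auto simp: in_keys_iff)

lemma mp_monom_add: "mp_monom G (\<alpha> + \<beta>) = mp_monom G \<alpha> * mp_monom G \<beta>"
proof -
  let ?A = "Poly_Mapping.keys \<alpha> \<union> Poly_Mapping.keys \<beta>"
  have "mp_monom G (\<alpha> + \<beta>) = (\<Prod>j\<in>?A. G j ^ Poly_Mapping.lookup (\<alpha> + \<beta>) j)"
    by (intro mp_monom_superset) (auto simp: in_keys_iff lookup_add)
  also have "\<dots> = mp_monom G \<alpha> * mp_monom G \<beta>"
    by (simp add: mp_monom_superset[of ?A] lookup_add power_add prod.distrib)
  finally show ?thesis .
qed

lemma mp_monom_zero [simp]: "mp_monom G 0 = 1"
  by (simp add: mp_monom_def)

lemma mp_monom_single: "mp_monom G (Poly_Mapping.single i k) = G i ^ k"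
  by (simp add: mp_monom_def)

lemma mp_monom_Var: "mp_monom mp_Var \<alpha> = (Poly_Mapping.single \<alpha> 1 :: 'a::comm_ring_1 mpoly)"
proof (induction \<alpha> rule: poly_mapping_additive_induct)
  case (1 i k)
  have "(mp_Var i :: 'a mpoly) ^ k = Poly_Mapping.single (Poly_Mapping.single i k) 1"
    by (induction k) (auto simp: mp_Var_def mult_single single_add[symmetric])
  then show ?case by (simp add: mp_monom_single)
qed (simp add: mp_monom_add mult_single)

locale unital_hom =
  fixes h :: "'a::comm_ring_1 \<Rightarrow> 'b::comm_ring_1"
  assumes one [simp]: "h 1 = 1"
    and add: "h (x + y) = h x + h y"
    and mult: "h (x * y) = h x * h y"
begin

lemma zero [simp]: "h 0 = 0"
  using add[of 0 0] by simp

lemma uminus: "h (- x) = - h x"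
  using add[of x "- x"] by (simp add: eq_neg_iff_add_eq_0 add.commute)

lemma diff: "h (x - y) = h x - h y"
  using add[of x "- y"] by (simp add: uminus)

lemma sum: "h (\<Sum>i\<in>A. f i) = (\<Sum>i\<in>A. h (f i))"
  by (induction A rule: infinite_finite_induct) (auto simp: add)

lemma power: "h (x ^ k) = h x ^ k"
  by (induction k) (auto simp: mult)

end

text \<open>The coefficient map \<open>c\<close> is kept general because two targets are needed:
  \<open>mp_Const\<close> gives \<open>mp_subst\<close>, and constant univariate polynomials give
  the restriction to a line.\<close>

definition mp_eval :: "('a::comm_ring_1 \<Rightarrow> 'b::comm_ring_1) \<Rightarrow> (nat \<Rightarrow> 'b) \<Rightarrow> 'a mpoly \<Rightarrow> 'b" where
  "mp_eval c G f = (\<Sum>\<alpha>\<in>Poly_Mapping.keys f. c (Poly_Mapping.lookup f \<alpha>) * mp_monom G \<alpha>)"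

lemma mp_subst_eq_eval: "mp_subst f G = mp_eval mp_Const G f"
  by (simp add: mp_subst_def mp_eval_def mp_monom_def)

lemma mp_eval_cong:
  assumes "mp_vars_in V f" "\<And>j. j \<in> V \<Longrightarrow> G j = G' j"
  shows "mp_eval c G f = mp_eval c G' f"
  using assms unfolding mp_eval_def mp_monom_def mp_vars_in_def
  by (intro sum.cong arg_cong2[where f = "(*)"] prod.cong refl arg_cong2[where f = "(^)"]) blast

context unital_hom
begin

lemma mp_eval_single: "mp_eval h G (Poly_Mapping.single \<alpha> a) = h a * mp_monom G \<alpha>"
  by (cases "a = 0") (auto simp: mp_eval_def)

lemma mp_eval_add: "mp_eval h G (f + g) = mp_eval h G f + mp_eval h G g"
  unfolding mp_eval_def
  by (rule setsum_keys_plus_distrib) (auto simp: add algebra_simps)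

lemma mp_eval_mult: "mp_eval h G (f * g) = mp_eval h G f * mp_eval h G g"
proof (induction f rule: poly_mapping_additive_induct)
  case (1 k v)
  show ?case
    by (induction g rule: poly_mapping_additive_induct)
      (simp_all add: mult_single mp_eval_single mp_eval_add mp_monom_add mult algebra_simps)
qed (simp add: algebra_simps mp_eval_add)

lemma mp_eval_Const: "mp_eval h G (mp_Const a) = h a"
  by (simp add: mp_Const_def mp_eval_single)

lemma mp_eval_Var: "mp_eval h G (mp_Var i) = G i"
  by (simp add: mp_Var_def mp_eval_single mp_monom_single)

lemma mp_eval_unital_hom: "unital_hom (mp_eval h G)"
proof
  show "mp_eval h G 1 = 1"
    using mp_eval_Const[of G 1] by (simp add: mp_Const_def)
qed (simp_all add: mp_eval_add mp_eval_mult)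

end

interpretation mp_Const: unital_hom mp_Const
  by unfold_locales (simp_all add: mp_Const_def single_add mult_single)

interpretation mp_subst: unital_hom "\<lambda>f. mp_subst f G" for G :: "nat \<Rightarrow> 'a::comm_ring_1 mpoly"
  unfolding mp_subst_eq_eval by (rule mp_Const.mp_eval_unital_hom)

lemma mp_subst_Const [simp]: "mp_subst (mp_Const c) G = mp_Const c"
  by (simp add: mp_subst_eq_eval mp_Const.mp_eval_Const)

lemma mp_subst_Var [simp]: "mp_subst (mp_Var i) G = G i"
  by (simp add: mp_subst_eq_eval mp_Const.mp_eval_Var)

lemma mp_subst_cong:
  assumes "mp_vars_in V f" "\<And>j. j \<in> V \<Longrightarrow> G j = G' j"
  shows "mp_subst f G = mp_subst f G'"
  unfolding mp_subst_eq_eval by (rule mp_eval_cong[OF assms])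

lemma lookup_mp_Const_mult:
  "Poly_Mapping.lookup (mp_Const c * f) \<alpha> = c * Poly_Mapping.lookup f \<alpha>"
proof (induction f rule: poly_mapping_additive_induct)
  case (1 k v)
  show ?case by (simp add: mp_Const_def mult_single lookup_single when_def)
qed (simp add: algebra_simps lookup_add)

lemma mp_Const_eq_iff [simp]: "mp_Const a = mp_Const b \<longleftrightarrow> a = b"
  by (metis mp_Const_def lookup_single_eq)

lemma mp_Const_eq_0_iff [simp]: "mp_Const a = 0 \<longleftrightarrow> a = 0"
  by (metis mp_Const_def lookup_single_eq lookup_zero single_zero)

section \<open>Polynomial rings F[x_i : i in V] as subsets of one type\<close>

definition mp_in :: "'a::zero set \<Rightarrow> nat set \<Rightarrow> 'a mpoly set" where
  "mp_in F V = {f. mp_coeffs_in F f \<and> mp_vars_in V f}"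

lemma mp_in_mono: "F \<subseteq> F' \<Longrightarrow> V \<subseteq> V' \<Longrightarrow> mp_in F V \<subseteq> mp_in F' V'"
  by (force simp: mp_in_def mp_coeffs_in_def mp_vars_in_def)

lemma mp_in_UNIV [simp]: "f \<in> mp_in UNIV UNIV"
  by (simp add: mp_in_def mp_coeffs_in_def mp_vars_in_def)

text \<open>A notion common to the coefficient fields, the polynomial rings over them and the images
  of these under substitution.\<close>

definition is_subring :: "'b::comm_ring_1 set \<Rightarrow> bool" where
  "is_subring S \<longleftrightarrow> 0 \<in> S \<and> 1 \<in> S \<and> (\<forall>a\<in>S. \<forall>b\<in>S. a + b \<in> S \<and> a * b \<in> S) \<and> (\<forall>a\<in>S. - a \<in> S)"

context
  fixes S :: "'b::comm_ring_1 set"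
  assumes S: "is_subring S"
begin

lemma subring_0: "0 \<in> S" and subring_1: "1 \<in> S"
  and subring_add: "a \<in> S \<Longrightarrow> b \<in> S \<Longrightarrow> a + b \<in> S"
  and subring_mult: "a \<in> S \<Longrightarrow> b \<in> S \<Longrightarrow> a * b \<in> S"
  and subring_uminus: "a \<in> S \<Longrightarrow> - a \<in> S"
  using S by (auto simp: is_subring_def)

lemma subring_diff: "a \<in> S \<Longrightarrow> b \<in> S \<Longrightarrow> a - b \<in> S"
  using subring_add[of a "- b"] subring_uminus[of b] by simp

lemma subring_sum: "(\<And>i. i \<in> A \<Longrightarrow> f i \<in> S) \<Longrightarrow> (\<Sum>i\<in>A. f i) \<in> S"
  by (induction A rule: infinite_finite_induct) (auto intro: subring_0 subring_add)

lemma subring_power: "a \<in> S \<Longrightarrow> a ^ k \<in> S"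
  by (induction k) (auto intro: subring_1 subring_mult)

lemma subring_of_nat: "of_nat k \<in> S"
  by (induction k) (auto intro: subring_0 subring_1 subring_add)

end

lemmas subring_closed = subring_0 subring_1 subring_add subring_mult subring_uminus subring_diff
  subring_sum subring_power subring_of_nat

lemma subfield_subring: "is_subfield F \<Longrightarrow> is_subring F"
  by (simp add: is_subfield_def is_subring_def)

lemma subfield_divide: "is_subfield F \<Longrightarrow> a \<in> F \<Longrightarrow> b \<in> F \<Longrightarrow> a / b \<in> F"
  by (auto simp: is_subfield_def divide_inverse)

lemma single_in_mp_in:
  assumes "0 \<in> F" "c \<in> F" "Poly_Mapping.keys \<alpha> \<subseteq> V"
  shows "Poly_Mapping.single \<alpha> c \<in> mp_in F V"
  using assms by (auto simp: mp_in_def mp_coeffs_in_def mp_vars_in_def lookup_single when_def)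

lemma mp_in_subring:
  assumes F: "is_subring F"
  shows "is_subring (mp_in F V)"
proof -
  have add: "f + g \<in> mp_in F V" if fg: "f \<in> mp_in F V" "g \<in> mp_in F V" for f g
  proof -
    have "mp_vars_in V (f + g)"
      using fg keys_add[of f g] unfolding mp_in_def mp_vars_in_def by blast
    then show ?thesis
      using fg F by (auto simp: mp_in_def mp_coeffs_in_def lookup_add intro: subring_add)
  qed
  have zero: "0 \<in> mp_in F V" and one: "1 \<in> mp_in F V"
    using single_in_mp_in[of F 0 0] single_in_mp_in[of F 1 0] by (simp_all add: subring_closed[OF F])
  have sum: "(\<Sum>i\<in>A. f i) \<in> mp_in F V" if "\<And>i. i \<in> A \<Longrightarrow> f i \<in> mp_in F V"
    for f :: "(nat \<Rightarrow>\<^sub>0 nat) \<Rightarrow> 'a mpoly" and A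
    using that by (induction A rule: infinite_finite_induct) (auto intro: add zero)
  have "f * g \<in> mp_in F V" if f: "f \<in> mp_in F V" and g: "g \<in> mp_in F V" for f g
  proof -
    let ?l = Poly_Mapping.lookup and ?k = Poly_Mapping.keys
    have "f * g = (\<Sum>\<alpha>\<in>?k f. \<Sum>\<beta>\<in>?k g. Poly_Mapping.single (\<alpha> + \<beta>) (?l f \<alpha> * ?l g \<beta>))"
      by (subst poly_mapping_sum_singles[of f], subst poly_mapping_sum_singles[of g])
        (simp add: sum_product mult_single)
    also have "\<dots> \<in> mp_in F V"
    proof (intro sum single_in_mp_in)
      fix \<alpha> \<beta> assume \<alpha>\<beta>: "\<alpha> \<in> ?k f" "\<beta> \<in> ?k g"
      show "0 \<in> F" "?l f \<alpha> * ?l g \<beta> \<in> F"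
        using f g by (simp_all add: mp_in_def mp_coeffs_in_def subring_closed[OF F])
      show "?k (\<alpha> + \<beta>) \<subseteq> V"
        using f g \<alpha>\<beta> keys_add[of \<alpha> \<beta>] unfolding mp_in_def mp_vars_in_def by blast
    qed
    finally show ?thesis .
  qed
  moreover have "- f \<in> mp_in F V" if "f \<in> mp_in F V" for f
    using that F
    by (auto simp: is_subring_def mp_in_def mp_coeffs_in_def mp_vars_in_def in_keys_iff)
  ultimately show ?thesis
    unfolding is_subring_def using add zero one by blast
qed

lemma mp_Const_in: "is_subring F \<Longrightarrow> c \<in> F \<Longrightarrow> mp_Const c \<in> mp_in F V"
  unfolding mp_Const_def by (rule single_in_mp_in) (auto intro: subring_0)

lemma mp_Var_in: "is_subring F \<Longrightarrow> i \<in> V \<Longrightarrow> mp_Var i \<in> mp_in F V"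
  unfolding mp_Var_def by (rule single_in_mp_in) (auto intro: subring_0 subring_1)

text \<open>Every polynomial is built from constants and variables by sums and products. Two
  homomorphisms, or two derivations, are thus equal once they agree on constants and variables; most
  identities below are proved in this way.\<close>

lemma mp_in_induct [consumes 2, case_names Const Var add mult]:
  fixes F :: "'a::comm_ring_1 set"
  assumes F: "is_subring F" and f: "f \<in> mp_in F V"
    and Const: "\<And>c. c \<in> F \<Longrightarrow> P (mp_Const c)"
    and Var: "\<And>i. i \<in> V \<Longrightarrow> P (mp_Var i)"
    and add: "\<And>f g. f \<in> mp_in F V \<Longrightarrow> g \<in> mp_in F V \<Longrightarrow> P f \<Longrightarrow> P g \<Longrightarrow> P (f + g)"
    and mult: "\<And>f g. f \<in> mp_in F V \<Longrightarrow> g \<in> mp_in F V \<Longrightarrow> P f \<Longrightarrow> P g \<Longrightarrow> P (f * g)"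
  shows "P f"
proof -
  define S where "S = {f \<in> mp_in F V. P f}"
  note R = mp_in_subring[OF F, of V]
  have zero: "0 \<in> S" and one: "1 \<in> S"
    using Const[of 0] Const[of 1] by (simp_all add: S_def subring_closed[OF F] subring_closed[OF R])
  have Sadd: "f + g \<in> S" and Smult: "f * g \<in> S" if "f \<in> S" "g \<in> S" for f g
    using that by (simp_all add: S_def add mult subring_closed[OF R])
  have pow: "f ^ k \<in> S" if "f \<in> S" for f k
    using that by (induction k) (auto intro: one Smult)
  have prod: "(\<Prod>i\<in>A. g i) \<in> S" if "\<And>i. i \<in> A \<Longrightarrow> g i \<in> S" for g :: "nat \<Rightarrow> 'a mpoly" and A
    using that by (induction A rule: infinite_finite_induct) (auto intro: one Smult)
  have sum: "(\<Sum>i\<in>A. g i) \<in> S" if "\<And>i. i \<in> A \<Longrightarrow> g i \<in> S"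
    for g :: "(nat \<Rightarrow>\<^sub>0 nat) \<Rightarrow> 'a mpoly" and A
    using that by (induction A rule: infinite_finite_induct) (auto intro: zero Sadd)
  have "f = (\<Sum>\<alpha>\<in>Poly_Mapping.keys f. mp_Const (Poly_Mapping.lookup f \<alpha>) * mp_monom mp_Var \<alpha>)"
    by (subst poly_mapping_sum_singles) (simp add: mp_monom_Var mp_Const_def mult_single)
  also have "\<dots> \<in> S"
    unfolding mp_monom_def
  proof (intro sum Smult prod pow)
    fix \<alpha> assume \<alpha>: "\<alpha> \<in> Poly_Mapping.keys f"
    have "Poly_Mapping.lookup f \<alpha> \<in> F"
      using f by (simp add: mp_in_def mp_coeffs_in_def)
    then show "mp_Const (Poly_Mapping.lookup f \<alpha>) \<in> S"
      by (simp add: S_def Const mp_Const_in[OF F])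
    fix j assume "j \<in> Poly_Mapping.keys \<alpha>"
    then have "j \<in> V"
      using f \<alpha> by (auto simp: mp_in_def mp_vars_in_def)
    then show "mp_Var j \<in> S"
      by (simp add: S_def Var mp_Var_in[OF F])
  qed
  finally show ?thesis by (simp add: S_def)
qed

section \<open>Modules spanned by finitely many elements\<close>

text \<open>More unknowns than equations force a nontrivial solution. Gaussian elimination is done
  by cross-multiplication, so that no division leaves \<open>D\<close>; a pivot stays harmless
  because the ambient ring is a domain.\<close>

lemma fraction_free_dependence:
  fixes c :: "'i \<Rightarrow> 'w \<Rightarrow> 'b::idom"
  assumes D: "is_subring D" and W: "finite W"
    and "finite I" "card W < card I" "\<And>i w. i \<in> I \<Longrightarrow> w \<in> W \<Longrightarrow> c i w \<in> D"
  shows "\<exists>q. (\<forall>i\<in>I. q i \<in> D) \<and> (\<exists>i\<in>I. q i \<noteq> 0) \<and> (\<forall>w\<in>W. (\<Sum>i\<in>I. q i * c i w) = 0)"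
  using W assms(3-)
proof (induction W arbitrary: I c rule: finite_induct)
  case empty
  then have "I \<noteq> {}" by auto
  then show ?case
    using subring_1[OF D] by (intro exI[of _ "\<lambda>_. 1"]) auto
next
  case (insert w0 W)
  show ?case
  proof (cases "\<forall>i\<in>I. c i w0 = 0")
    case True
    have "\<exists>q. (\<forall>i\<in>I. q i \<in> D) \<and> (\<exists>i\<in>I. q i \<noteq> 0) \<and> (\<forall>w\<in>W. (\<Sum>i\<in>I. q i * c i w) = 0)"
      using insert.prems insert.hyps by (intro insert.IH) auto
    then show ?thesis using True by auto
  next
    case False
    then obtain i0 where i0: "i0 \<in> I" "c i0 w0 \<noteq> 0" by auto
    define J where "J = I - {i0}"
    \<comment> \<open>The equation for \<open>w0\<close> is eliminated with the pivot
      \<open>c i0 w0\<close>.\<close>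
    define c' where "c' i w = c i0 w0 * c i w - c i w0 * c i0 w" for i w
    have I: "I = insert i0 J" "i0 \<notin> J" "finite J"
      using i0 insert.prems by (auto simp: J_def)
    have "\<exists>q. (\<forall>i\<in>J. q i \<in> D) \<and> (\<exists>i\<in>J. q i \<noteq> 0) \<and> (\<forall>w\<in>W. (\<Sum>i\<in>J. q i * c' i w) = 0)"
    proof (rule insert.IH)
      show "card W < card J"
        using insert.prems(2) insert.hyps I by simp
      show "c' i w \<in> D" if "i \<in> J" "w \<in> W" for i w
        using that insert.prems(3) i0 unfolding c'_def J_def by (simp add: subring_closed[OF D])
    qed (use I in simp)
    then obtain q where q: "\<forall>i\<in>J. q i \<in> D" "\<exists>i\<in>J. q i \<noteq> 0"
      "\<forall>w\<in>W. (\<Sum>i\<in>J. q i * c' i w) = 0" by blast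
    \<comment> \<open>Back-substitution: the value at \<open>i0\<close> is forced by the equation
      for \<open>w0\<close> once the other values are multiplied by the pivot.\<close>
    define q' where "q' i = (if i = i0 then - (\<Sum>i\<in>J. q i * c i w0) else c i0 w0 * q i)" for i
    have q'J: "(\<Sum>i\<in>J. q' i * c i w) = c i0 w0 * (\<Sum>i\<in>J. q i * c i w)" for w
      using I(2) by (auto simp: q'_def sum_distrib_left mult_ac intro!: sum.cong)
    show ?thesis
    proof (intro exI conjI ballI)
      fix i assume "i \<in> I"
      have "- (\<Sum>i\<in>J. q i * c i w0) \<in> D"
        using q(1) insert.prems(3) unfolding J_def
        by (intro subring_uminus[OF D] subring_sum[OF D] subring_mult[OF D]) auto
      then show "q' i \<in> D"
        using q(1) insert.prems(3) \<open>i \<in> I\<close> i0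
        by (auto simp: q'_def J_def subring_closed[OF D])
    next
      show "\<exists>i\<in>I. q' i \<noteq> 0"
        using q(2) i0 by (auto simp: q'_def J_def)
    next
      fix w assume w: "w \<in> insert w0 W"
      have "(\<Sum>i\<in>I. q' i * c i w) =
          c i0 w0 * (\<Sum>i\<in>J. q i * c i w) - (\<Sum>i\<in>J. q i * c i w0) * c i0 w"
        using I q'J by (simp add: q'_def)
      also have "\<dots> = (if w = w0 then 0 else \<Sum>i\<in>J. q i * c' i w)"
        by (simp add: c'_def sum_distrib_left sum_distrib_right sum_subtractf algebra_simps)
      finally show "(\<Sum>i\<in>I. q' i * c i w) = 0"
        using q(3) w by auto
    qed
  qed
qed

text \<open>The \<open>D\<close>-module generated by \<open>W\<close>, meant for finite
  \<open>W\<close> since an infinite sum is 0 by convention.\<close>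

definition lin_span :: "'b::comm_ring_1 set \<Rightarrow> 'b set \<Rightarrow> 'b set" where
  "lin_span D W = {z. \<exists>c. (\<forall>w\<in>W. c w \<in> D) \<and> z = (\<Sum>w\<in>W. c w * w)}"

context
  fixes D :: "'b::comm_ring_1 set"
  assumes D: "is_subring D"
begin

lemma lin_span_zero: "0 \<in> lin_span D W"
  unfolding lin_span_def by (auto intro!: exI[of _ "\<lambda>_. 0"] simp: subring_0[OF D])

lemma lin_span_add:
  assumes "u \<in> lin_span D W" "v \<in> lin_span D W" shows "u + v \<in> lin_span D W"
proof -
  obtain c d where "\<forall>w\<in>W. c w \<in> D" "u = (\<Sum>w\<in>W. c w * w)" "\<forall>w\<in>W. d w \<in> D" "v = (\<Sum>w\<in>W. d w * w)"
    using assms by (auto simp: lin_span_def)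
  then show ?thesis
    by (auto simp: lin_span_def sum.distrib algebra_simps subring_closed[OF D]
        intro!: exI[of _ "\<lambda>w. c w + d w"])
qed

lemma lin_span_scale:
  assumes "a \<in> D" "v \<in> lin_span D W" shows "a * v \<in> lin_span D W"
proof -
  obtain c where "\<forall>w\<in>W. c w \<in> D" "v = (\<Sum>w\<in>W. c w * w)"
    using assms by (auto simp: lin_span_def)
  then show ?thesis
    using assms(1) by (auto simp: lin_span_def sum_distrib_left algebra_simps subring_closed[OF D]
        intro!: exI[of _ "\<lambda>w. a * c w"])
qed

lemma lin_span_sum:
  "(\<And>i. i \<in> A \<Longrightarrow> f i \<in> lin_span D W) \<Longrightarrow> (\<Sum>i\<in>A. f i) \<in> lin_span D W"
  by (induction A rule: infinite_finite_induct) (auto intro: lin_span_zero lin_span_add)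

lemma lin_span_base:
  assumes "finite W" "w \<in> W" shows "w \<in> lin_span D W"
  unfolding lin_span_def using assms
  by (auto simp: subring_closed[OF D] sum.delta' if_distrib[of "\<lambda>x. x * _"] cong: if_cong
      intro!: exI[of _ "\<lambda>v. if v = w then 1 else 0"])

lemma lin_span_mult:
  assumes z: "\<And>w. w \<in> W \<Longrightarrow> z * w \<in> lin_span D W'" and v: "v \<in> lin_span D W"
  shows "z * v \<in> lin_span D W'"
proof -
  obtain c where c: "\<forall>w\<in>W. c w \<in> D" "v = (\<Sum>w\<in>W. c w * w)"
    using v by (auto simp: lin_span_def)
  have "z * v = (\<Sum>w\<in>W. c w * (z * w))"
    by (simp add: c sum_distrib_left algebra_simps)
  also have "\<dots> \<in> lin_span D W'"
    using c z by (intro lin_span_sum) (simp add: lin_span_scale)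
  finally show ?thesis .
qed

end

text \<open>For finite \<open>W\<close> these are the z with zV contained in V, where V is the span
  of \<open>W\<close> over the fraction field of \<open>D\<close>. The denominator \<open>d\<close>
  replaces the construction of that field.\<close>

definition multipliers :: "'b::idom set \<Rightarrow> 'b set \<Rightarrow> 'b set" where
  "multipliers D W =
     {z. \<exists>d\<in>D. d \<noteq> 0 \<and> (\<forall>v\<in>lin_span D W. d * z * v \<in> lin_span D W)}"

text \<open>Algebraicity over the fraction field of \<open>D\<close>, with denominators cleared; the
  leading coefficient of \<open>q\<close> need not be a unit.\<close>

definition algebraic_elem :: "'b::idom set \<Rightarrow> 'b \<Rightarrow> bool" where
  "algebraic_elem D x \<longleftrightarrow> (\<exists>q. q \<noteq> 0 \<and> (\<forall>i. coeff q i \<in> D) \<and> poly q x = 0)"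

context
  fixes D :: "'b::idom set"
  assumes D: "is_subring D"
begin

lemma multipliers_base: "a \<in> D \<Longrightarrow> a \<in> multipliers D W"
  unfolding multipliers_def
  by (auto intro!: bexI[of _ 1] simp: subring_1[OF D] lin_span_scale[OF D])

lemma multipliersI:
  assumes "d \<in> D" "d \<noteq> 0" "\<And>w. w \<in> W \<Longrightarrow> d * z * w \<in> lin_span D W"
  shows "z \<in> multipliers D W"
  unfolding multipliers_def using assms lin_span_mult[OF D assms(3)] by blast

lemma multipliers_add:
  assumes "y \<in> multipliers D W" "z \<in> multipliers D W"
  shows "y + z \<in> multipliers D W"
proof -
  obtain d e where de: "d \<in> D" "d \<noteq> 0" "\<And>v. v \<in> lin_span D W \<Longrightarrow> d * y * v \<in> lin_span D W"
    "e \<in> D" "e \<noteq> 0" "\<And>v. v \<in> lin_span D W \<Longrightarrow> e * z * v \<in> lin_span D W"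
    using assms by (auto simp: multipliers_def)
  have "d * e * (y + z) * v \<in> lin_span D W" if "v \<in> lin_span D W" for v
  proof -
    have "e * (d * y * v) + d * (e * z * v) \<in> lin_span D W"
      using that de(1,4) de(3,6)[OF that]
      by (simp only: lin_span_add[OF D] lin_span_scale[OF D])
    then show ?thesis by (simp add: algebra_simps)
  qed
  then show ?thesis
    using de subring_mult[OF D] unfolding multipliers_def by (auto intro!: bexI[of _ "d * e"])
qed

lemma multipliers_mult:
  assumes "y \<in> multipliers D W" "z \<in> multipliers D W"
  shows "y * z \<in> multipliers D W"
proof -
  obtain d e where de: "d \<in> D" "d \<noteq> 0" "\<And>v. v \<in> lin_span D W \<Longrightarrow> d * y * v \<in> lin_span D W"
    "e \<in> D" "e \<noteq> 0" "\<And>v. v \<in> lin_span D W \<Longrightarrow> e * z * v \<in> lin_span D W"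
    using assms by (auto simp: multipliers_def)
  have "d * e * (y * z) * v \<in> lin_span D W" if "v \<in> lin_span D W" for v
    using de(3)[OF de(6)[OF that]] by (simp add: algebra_simps)
  then show ?thesis
    using de subring_mult[OF D] unfolding multipliers_def by (auto intro!: bexI[of _ "d * e"])
qed

text \<open>Algebraic elements are adjoined one at a time. If \<open>W\<close> serves for
  \<open>X\<close> and x satisfies an equation of degree a, then the products of the powers x^i, i <
  a, with \<open>W\<close> serve for x as well.\<close>

lemma finite_module_of_algebraic:
  assumes "finite X" "\<And>x. x \<in> X \<Longrightarrow> algebraic_elem D x"
  shows "\<exists>W. finite W \<and> 1 \<in> W \<and> X \<subseteq> multipliers D W"
  using assms
proof (induction X rule: finite_induct)
  case empty
  show ?case by (intro exI[of _ "{1}"]) auto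
next
  case (insert x X)
  then obtain W where W: "finite W" "1 \<in> W" "X \<subseteq> multipliers D W" by auto
  obtain q where q: "q \<noteq> 0" "\<And>i. coeff q i \<in> D" "poly q x = 0"
    using insert.prems[of x] by (auto simp: algebraic_elem_def)
  define a where "a = degree q"
  \<comment> \<open>A nonzero constant has no root. The exponent 0 is therefore allowed, which puts
    1 into the new generating set.\<close>
  have "a \<noteq> 0"
  proof
    assume "a = 0"
    then obtain c where "q = [:c:]" using degree_eq_zeroE unfolding a_def by blast
    then show False using q(1,3) by simp
  qed
  define W' where "W' = (\<lambda>(i, w). x ^ i * w) ` ({..<a} \<times> W)"
  have W'I: "x ^ i * w \<in> W'" if "i < a" "w \<in> W" for i w
    using that by (auto simp: W'_def)
  have fin: "finite W'" using W by (simp add: W'_def)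
  note base = lin_span_base[OF D fin W'I]
  have W'_power: "x ^ i * v \<in> lin_span D W'" if "i < a" "v \<in> lin_span D W" for i v
    by (rule lin_span_mult[OF D, where W = W]) (use that base in auto)
  have "y \<in> multipliers D W'" if y: "y \<in> X" for y
  proof -
    obtain d where d: "d \<in> D" "d \<noteq> 0" "\<And>v. v \<in> lin_span D W \<Longrightarrow> d * y * v \<in> lin_span D W"
      using y W(3) unfolding multipliers_def by blast
    have "d * y * w \<in> lin_span D W'" if w: "w \<in> W'" for w
    proof -
      obtain i u where iu: "w = x ^ i * u" "i < a" "u \<in> W"
        using w by (auto simp: W'_def)
      have "x ^ i * (d * y * u) \<in> lin_span D W'"
        using iu by (intro W'_power d(3) lin_span_base[OF D W(1)])
      then show ?thesis by (simp add: iu algebra_simps)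
    qed
    then show ?thesis
      using d by (intro multipliersI[of d])
  qed
  moreover have "x \<in> multipliers D W'"
  proof -
    \<comment> \<open>Multiplication by x only raises the exponent, except at the exponent a - 1,
      where the equation of x rewrites \<open>d * x ^ a\<close> by lower powers.\<close>
    define d where "d = lead_coeff q"
    have "d * x * w \<in> lin_span D W'" if w: "w \<in> W'" for w
    proof -
      obtain i u where iu: "w = x ^ i * u" "i < a" "u \<in> W"
        using w by (auto simp: W'_def)
      show ?thesis
      proof (cases "Suc i < a")
        case True
        then have "d * (x ^ Suc i * u) \<in> lin_span D W'"
          using q(2) iu by (intro lin_span_scale[OF D _ base]) (auto simp: d_def)
        then show ?thesis by (simp add: iu algebra_simps)
      next
        case False
        then have a: "a = Suc i" using iu by auto
        have "(\<Sum>k\<le>a. coeff q k * x ^ k) = 0"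
          using q(3) by (simp add: poly_altdef a_def)
        then have "d * x ^ a = - (\<Sum>k<a. coeff q k * x ^ k)"
          by (simp add: d_def a_def lessThan_Suc_atMost[symmetric] eq_neg_iff_add_eq_0 add.commute)
        then have "d * x * w = - (\<Sum>k<a. coeff q k * x ^ k) * u"
          unfolding iu(1) a by (metis mult.assoc power_Suc)
        also have "\<dots> = (\<Sum>k<a. - coeff q k * (x ^ k * u))"
          by (simp add: sum_distrib_right sum_negf mult.assoc)
        also have "\<dots> \<in> lin_span D W'"
          using q(2) iu by (intro lin_span_sum[OF D] lin_span_scale[OF D _ base] subring_uminus[OF D]) auto
        finally show ?thesis .
      qed
    qed
    moreover have "d \<in> D" "d \<noteq> 0" using q by (auto simp: d_def)
    ultimately show ?thesis
      by (intro multipliersI[of d])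
  qed
  moreover have "1 \<in> W'" using W'I[of 0 1] W \<open>a \<noteq> 0\<close> by simp
  ultimately show ?case using fin by (intro exI[of _ W']) auto
qed

text \<open>All products of powers of \<open>d * A\<close> and \<open>e * B\<close> lie in a module
  with \<open>card W\<close> generators, so sufficiently many of them are dependent over
  \<open>D\<close>. The relation is homogeneous so that it becomes an equation for the ratio of
  \<open>A\<close> and \<open>B\<close>.\<close>

lemma multipliers_homogeneous_relation:
  assumes W: "finite W" "1 \<in> W" and AB: "A \<in> multipliers D W" "B \<in> multipliers D W"
  shows "\<exists>N q. (\<forall>i\<le>N. q i \<in> D) \<and> (\<exists>i\<le>N. q i \<noteq> 0) \<and> (\<Sum>i\<le>N. q i * A ^ i * B ^ (N - i)) = 0"
proof -
  obtain d e where de: "d \<in> D" "d \<noteq> 0" "\<And>v. v \<in> lin_span D W \<Longrightarrow> d * A * v \<in> lin_span D W"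
    "e \<in> D" "e \<noteq> 0" "\<And>v. v \<in> lin_span D W \<Longrightarrow> e * B * v \<in> lin_span D W"
    using AB by (auto simp: multipliers_def)
  \<comment> \<open>The exponents 0 to N give N + 1 products, one more than there are
    generators.\<close>
  define N where "N = card W"
  have B: "(e * B) ^ k \<in> lin_span D W" for k
    using lin_span_base[OF D W] de(6) by (induction k) (simp_all add: mult.assoc)
  have AB': "(d * A) ^ i * (e * B) ^ k \<in> lin_span D W" for i k
    using B de(3) by (induction i) (simp_all add: mult.assoc)
  define z where "z i = (d * A) ^ i * (e * B) ^ (N - i)" for i
  have "\<forall>i. \<exists>c. (\<forall>w\<in>W. c w \<in> D) \<and> z i = (\<Sum>w\<in>W. c w * w)"
    using AB' by (simp add: z_def lin_span_def)
  then obtain c where c: "\<And>i w. w \<in> W \<Longrightarrow> c i w \<in> D" "\<And>i. z i = (\<Sum>w\<in>W. c i w * w)"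
    by metis
  obtain q where q: "\<forall>i\<in>{..N}. q i \<in> D" "\<exists>i\<in>{..N}. q i \<noteq> 0"
    "\<forall>w\<in>W. (\<Sum>i\<le>N. q i * c i w) = 0"
    using fraction_free_dependence[OF D W(1), of "{..N}" c] c(1) by (auto simp: N_def)
  have "(\<Sum>i\<le>N. q i * z i) = (\<Sum>w\<in>W. (\<Sum>i\<le>N. q i * c i w) * w)"
    unfolding c(2) sum_distrib_left sum_distrib_right by (subst sum.swap) (simp add: mult.assoc)
  also have "\<dots> = 0" using q(3) by simp
  finally have "(\<Sum>i\<le>N. q i * d ^ i * e ^ (N - i) * A ^ i * B ^ (N - i)) = 0"
    by (simp add: z_def power_mult_distrib mult_ac)
  moreover have "\<forall>i\<le>N. q i * d ^ i * e ^ (N - i) \<in> D"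
    using q(1) de by (simp add: subring_closed[OF D])
  moreover have "\<exists>i\<le>N. q i * d ^ i * e ^ (N - i) \<noteq> 0"
    using q(2) de by auto
  ultimately show ?thesis
    by (intro exI[of _ N] exI[of _ "\<lambda>i. q i * d ^ i * e ^ (N - i)"]) auto
qed

end

section \<open>Polynomials in one distinguished variable\<close>

lemma (in unital_hom) poly_map_poly: "h (poly q x) = poly (map_poly h q) (h x)"
  by (induction q) (simp_all add: map_poly_pCons add mult)

text \<open>The variable x_j is singled out, with coefficients free of it. This serves both
  inductions on the number of variables and algebraic equations for a single component of
  \<open>H\<close>.\<close>

lemma mp_in_as_poly:
  assumes F: "is_subring F" and f: "f \<in> mp_in F V"
  shows "\<exists>q. (\<forall>i. coeff q i \<in> mp_in F (V - {j})) \<and> poly q (mp_Var j) = f"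
proof -
  note R = mp_in_subring[OF F, of "V - {j}"]
  show ?thesis
    using F f
  proof (induction f rule: mp_in_induct)
    case (Const c)
    show ?case
      using mp_Const_in[OF F Const]
      by (intro exI[of _ "[:mp_Const c:]"]) (auto simp: coeff_pCons subring_0[OF R] split: nat.split)
  next
    case (Var i)
    show ?case
    proof (cases "i = j")
      case True
      then show ?thesis
        by (intro exI[of _ "[:0, 1:]"])
          (auto simp: coeff_pCons subring_0[OF R] subring_1[OF R] split: nat.split)
    next
      case False
      then show ?thesis
        using mp_Var_in[OF F, of i "V - {j}"] Var
        by (intro exI[of _ "[:mp_Var i:]"]) (auto simp: coeff_pCons subring_0[OF R] split: nat.split)
    qed
  next
    case (add f g)
    then obtain p q where "\<forall>i. coeff p i \<in> mp_in F (V - {j})" "poly p (mp_Var j) = f"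
      "\<forall>i. coeff q i \<in> mp_in F (V - {j})" "poly q (mp_Var j) = g" by blast
    then show ?case
      by (intro exI[of _ "p + q"]) (simp add: subring_add[OF R])
  next
    case (mult f g)
    then obtain p q where "\<forall>i. coeff p i \<in> mp_in F (V - {j})" "poly p (mp_Var j) = f"
      "\<forall>i. coeff q i \<in> mp_in F (V - {j})" "poly q (mp_Var j) = g" by blast
    then show ?case
      by (intro exI[of _ "p * q"]) (simp add: coeff_mult subring_closed[OF R])
  qed
qed

lemma mp_in_no_vars:
  fixes f :: "'a::comm_ring_1 mpoly"
  assumes "is_subring F" "f \<in> mp_in F {}"
  obtains c where "c \<in> F" "f = mp_Const c"
proof -
  have "\<exists>c\<in>F. f = mp_Const c"
    using assms
    by (induction f rule: mp_in_induct)
      (auto simp flip: mp_Const.add mp_Const.mult simp: subring_closed[OF assms(1)])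
  then show ?thesis using that by blast
qed

section \<open>Specialisation at points with natural coordinates\<close>

lemma infinite_const_of_nat: "infinite (range (\<lambda>k. mp_Const (of_nat k :: 'a::field_char_0)))"
  by (rule range_inj_infinite) (simp add: inj_on_def)

lemma UNIV_subring: "is_subring UNIV"
  by (simp add: is_subring_def)

text \<open>Induction on the variables: at a point where the leading coefficient does not vanish,
  the remaining univariate polynomial has finitely many roots, while characteristic zero provides
  infinitely many naturals. Natural coordinates lie in every subring, so specialising does not
  enlarge the coefficient field.\<close>

lemma mp_nonzero_at_nat_point:
  fixes f :: "'a::field_char_0 mpoly"
  assumes "f \<noteq> 0"
  shows "\<exists>a :: nat \<Rightarrow> nat. mp_subst f (\<lambda>j. mp_Const (of_nat (a j))) \<noteq> 0"
proof -
  have *: "\<exists>a :: nat \<Rightarrow> nat. mp_subst f (\<lambda>j. mp_Const (of_nat (a j))) \<noteq> 0"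
    if "finite V" "f \<in> mp_in UNIV V" "f \<noteq> 0" for V and f :: "'a mpoly"
    using that
  proof (induction V arbitrary: f rule: finite_induct)
    case empty
    then show ?case by (auto elim!: mp_in_no_vars[OF UNIV_subring])
  next
    case (insert j V)
    obtain q where q: "\<And>i. coeff q i \<in> mp_in UNIV V" "poly q (mp_Var j) = f"
      using mp_in_as_poly[OF UNIV_subring insert.prems(1), of j] insert.hyps by auto
    then have "q \<noteq> 0" using insert.prems by auto
    then obtain a :: "nat \<Rightarrow> nat" where a: "mp_subst (lead_coeff q) (\<lambda>j. mp_Const (of_nat (a j))) \<noteq> 0"
      using insert.IH[OF q(1), of "degree q"] by auto
    define r where "r = map_poly (\<lambda>f. mp_subst f (\<lambda>j. mp_Const (of_nat (a j)))) q"
    have "coeff r (degree q) \<noteq> 0" using a by (simp add: r_def coeff_map_poly)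
    then have "r \<noteq> 0" by auto
    then have "\<not> range (\<lambda>k. mp_Const (of_nat k :: 'a)) \<subseteq> {x. poly r x = 0}"
      using poly_roots_finite infinite_const_of_nat finite_subset by blast
    then obtain k :: nat where k: "poly r (mp_Const (of_nat k)) \<noteq> 0" by auto
    \<comment> \<open>Changing the coordinate \<open>j\<close> leaves the coefficients of
      \<open>q\<close> unaffected, since they involve only variables of \<open>V\<close>.\<close>
    let ?b = "\<lambda>i. mp_Const (of_nat ((a(j := k)) i) :: 'a)"
    have "map_poly (\<lambda>f. mp_subst f ?b) q = r"
    proof (rule poly_eqI)
      fix i
      have "mp_subst (coeff q i) ?b = mp_subst (coeff q i) (\<lambda>j. mp_Const (of_nat (a j)))"
        using q(1)[of i] insert.hyps by (intro mp_subst_cong[of V]) (auto simp: mp_in_def)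
      then show "coeff (map_poly (\<lambda>f. mp_subst f ?b) q) i = coeff r i"
        by (simp add: r_def coeff_map_poly)
    qed
    then have "mp_subst f ?b = poly r (mp_Const (of_nat k))"
      using mp_subst.poly_map_poly[of q "mp_Var j" ?b] by (simp add: q(2))
    then show ?case using k by (intro exI[of _ "a(j := k)"]) simp
  qed
  moreover have "f \<in> mp_in UNIV (\<Union>(Poly_Mapping.keys ` Poly_Mapping.keys f))"
    unfolding mp_in_def mp_coeffs_in_def mp_vars_in_def by blast
  ultimately show ?thesis
    using assms by (intro *[of "\<Union>(Poly_Mapping.keys ` Poly_Mapping.keys f)"]) simp_all
qed

lemma mp_subst_in:
  assumes F: "is_subring F" and f: "f \<in> mp_in F V" and G: "\<And>j. j \<in> V \<Longrightarrow> G j \<in> mp_in F V'"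
  shows "mp_subst f G \<in> mp_in F V'"
  using F f
  by (induction f rule: mp_in_induct)
    (simp_all add: G mp_Const_in[OF F] mp_subst.add mp_subst.mult subring_closed[OF mp_in_subring[OF F]])

lemma mp_subst_comp:
  "mp_subst (mp_subst f G) G' = mp_subst f (\<lambda>j. mp_subst (G j) G')"
  using UNIV_subring mp_in_UNIV[of f]
  by (induction f rule: mp_in_induct) (simp_all add: mp_subst.add mp_subst.mult)

lemma mp_subst_Var_id: "mp_subst f mp_Var = f"
  using UNIV_subring mp_in_UNIV[of f]
  by (induction f rule: mp_in_induct) (simp_all add: mp_subst.add mp_subst.mult)

abbreviation mp_point :: "(nat \<Rightarrow> nat) \<Rightarrow> nat \<Rightarrow> 'a::comm_ring_1 mpoly" where
  "mp_point a \<equiv> \<lambda>j. mp_Const (of_nat (a j))"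

lemma mp_subst_point:
  assumes "is_subring F" "f \<in> mp_in F V"
  obtains c where "c \<in> F" "mp_subst f (mp_point a) = mp_Const c"
proof -
  have "mp_subst f (mp_point a) \<in> mp_in F {}"
    using assms by (intro mp_subst_in[of F f V] mp_Const_in) (auto simp: subring_of_nat)
  then show ?thesis using that mp_in_no_vars[OF assms(1)] by blast
qed

lemma alg_indep_iff: "alg_indep F H S \<longleftrightarrow> (\<forall>f\<in>mp_in F S. mp_subst f H = 0 \<longrightarrow> f = 0)"
  by (auto simp: alg_indep_def mp_in_def)

lemma alg_indep_empty: "is_subring F \<Longrightarrow> alg_indep F H {}"
  by (auto simp: alg_indep_iff elim!: mp_in_no_vars)

lemma (in unital_hom) image_subring:
  assumes S: "is_subring S" shows "is_subring (h ` S)"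
proof -
  have "0 \<in> h ` S" "1 \<in> h ` S"
    using subring_0[OF S] subring_1[OF S] by (force intro: image_eqI[of _ h 0] image_eqI[of _ h 1])+
  then show ?thesis
    unfolding is_subring_def using subring_closed[OF S]
    by (auto simp flip: add mult uminus)
qed

section \<open>Linear disjointness\<close>

locale alg_closed_extension =
  fixes K L :: "'a::field_char_0 set"
  assumes K: "is_subfield K" and L: "is_subfield L" and KL: "K \<subseteq> L"
    and closed: "alg_closed_in K L"
begin

lemmas Kr = subfield_subring[OF K] and Lr = subfield_subring[OF L]

text \<open>The components indexed by \<open>S\<close> form a transcendence basis of $F(H)$ for both $F = K$ and $F = L$.\<close>

definition same_trdeg :: "(nat \<Rightarrow> 'a mpoly) \<Rightarrow> nat \<Rightarrow> nat \<Rightarrow> nat set \<Rightarrow> bool" where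
  "same_trdeg H n m S \<longleftrightarrow> S \<subseteq> {..<m} \<and> (\<forall>j<m. H j \<in> mp_in L {..<n}) \<and> alg_indep L H S \<and>
     (\<forall>j<m. j \<notin> S \<longrightarrow> \<not> alg_indep K H (insert j S))"

text \<open>Let \<open>S\<close> be a largest set independent over L. If adding one more index gave
  a set independent over K, the transcendence degree over K would exceed the one over L.\<close>

lemma same_trdeg_exists:
  assumes H: "\<And>j. j < m \<Longrightarrow> H j \<in> mp_in L {..<n}" and tr: "trdeg K H m \<le> trdeg L H m"
  shows "\<exists>S. same_trdeg H n m S"
proof -
  let ?C = "\<lambda>F. {card S | S. S \<subseteq> {..<m} \<and> alg_indep F H S}"
  have fin: "finite (?C F)" for F
    by (rule finite_subset[of _ "card ` Pow {..<m}"]) auto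
  have "alg_indep L H {}" by (rule alg_indep_empty[OF Lr])
  then have "?C L \<noteq> {}" by blast
  then have "trdeg L H m \<in> ?C L"
    unfolding trdeg_def by (intro Max_in fin)
  then obtain S where S: "S \<subseteq> {..<m}" "alg_indep L H S" "card S = trdeg L H m" by auto
  have "\<not> alg_indep K H (insert j S)" if "j < m" "j \<notin> S" for j
  proof
    assume "alg_indep K H (insert j S)"
    then have "card (insert j S) \<in> ?C K" using that S(1) by blast
    then have "card (insert j S) \<le> trdeg K H m"
      unfolding trdeg_def by (intro Max_ge fin)
    then show False
      using tr S that finite_subset[OF S(1)] by simp
  qed
  then show ?thesis using S H by (auto simp: same_trdeg_def)
qed

context
  fixes H n m S
  assumes good: "same_trdeg H n m S"
begin

abbreviation (input) base_ring :: "'a mpoly set" where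
  "base_ring \<equiv> (\<lambda>f. mp_subst f H) ` mp_in K S"

lemma base_ring: "is_subring base_ring"
  by (intro mp_subst.image_subring mp_in_subring Kr)

lemma alg_indep_K: "f \<in> mp_in K S \<Longrightarrow> mp_subst f H = 0 \<Longrightarrow> f = 0"
  using good mp_in_mono[OF KL subset_refl, of S] by (auto simp: same_trdeg_def alg_indep_iff)

text \<open>For j outside \<open>S\<close> a relation between H_j and the components in
  \<open>S\<close> is read as a univariate polynomial in x_j. Its leading coefficient stays nonzero
  after substitution because the components in \<open>S\<close> are independent.\<close>

lemma components_algebraic:
  assumes j: "j < m"
  shows "algebraic_elem base_ring (H j)"
proof (cases "j \<in> S")
  case True
  then have "H j \<in> base_ring" using mp_Var_in[OF Kr True] by force
  then show ?thesis
    unfolding algebraic_elem_def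
    by (intro exI[of _ "[:- H j, 1:]"])
      (auto simp: coeff_pCons subring_closed[OF base_ring] split: nat.split)
next
  case False
  then obtain f where f: "f \<in> mp_in K (insert j S)" "mp_subst f H = 0" "f \<noteq> 0"
    using good j by (auto simp: same_trdeg_def alg_indep_iff)
  obtain q where q: "\<And>i. coeff q i \<in> mp_in K S" "poly q (mp_Var j) = f"
    using mp_in_as_poly[OF Kr f(1), of j] False by auto
  let ?r = "map_poly (\<lambda>f. mp_subst f H) q"
  have "q \<noteq> 0" using q f by auto
  then have "coeff ?r (degree q) \<noteq> 0"
    using alg_indep_K[OF q(1), of "degree q"] by (auto simp: coeff_map_poly)
  then have "?r \<noteq> 0" by auto
  moreover have "coeff ?r i \<in> base_ring" for i
    using q(1)[of i] by (auto simp: coeff_map_poly)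
  moreover have "poly ?r (H j) = 0"
    using mp_subst.poly_map_poly[of q "mp_Var j" H] q f by simp
  ultimately show ?thesis unfolding algebraic_elem_def by blast
qed

text \<open>The constant e lies in L and is algebraic over K(H_S). Independence of H_S over L turns
  the algebraic relation into an identity of polynomials, and one of its coefficients is an equation
  for e over K. Algebraic closedness of K in L finishes.\<close>

lemma ratio_in_K:
  assumes f: "f \<in> mp_in K {..<m}" and g: "g \<in> mp_in K {..<m}"
    and nz: "mp_subst f H \<noteq> 0" and eq: "mp_Const e * mp_subst f H = mp_subst g H"
  shows "e \<in> K"
proof -
  note D = base_ring
  obtain W where W: "finite W" "1 \<in> W" "H ` {..<m} \<subseteq> multipliers base_ring W"
    using finite_module_of_algebraic[OF D, of "H ` {..<m}"] components_algebraic by auto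
  have mul: "mp_subst h H \<in> multipliers base_ring W" if "h \<in> mp_in K {..<m}" for h
    using Kr that
  proof (induction h rule: mp_in_induct)
    case (Const c)
    then have "mp_Const c \<in> base_ring" using mp_Const_in[OF Kr Const, of S] by force
    then show ?case using multipliers_base[OF D] by simp
  qed (use W(3) multipliers_add[OF D] multipliers_mult[OF D] in
        \<open>auto simp: mp_subst.add mp_subst.mult\<close>)
  define A where "A = mp_subst f H"
  obtain N q where q: "\<forall>i\<le>N. q i \<in> base_ring" "\<exists>i\<le>N. q i \<noteq> 0"
    "(\<Sum>i\<le>N. q i * mp_subst g H ^ i * A ^ (N - i)) = 0"
    using multipliers_homogeneous_relation[OF D W(1,2) mul[OF g] mul[OF f]]
    unfolding A_def by blast
  \<comment> \<open>As g(H) = e A, every term carries the factor A^N, which can be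
    cancelled.\<close>
  have "(\<Sum>i\<le>N. q i * mp_subst g H ^ i * A ^ (N - i)) = (\<Sum>i\<le>N. mp_Const (e ^ i) * q i) * A ^ N"
    unfolding sum_distrib_right
    by (intro sum.cong refl)
      (simp add: A_def eq[symmetric] power_mult_distrib mp_Const.power mult_ac flip: power_add)
  then have "(\<Sum>i\<le>N. mp_Const (e ^ i) * q i) = 0"
    using q(3) nz by (simp add: A_def)
  moreover have "\<forall>i. \<exists>h. i \<le> N \<longrightarrow> h \<in> mp_in K S \<and> q i = mp_subst h H"
    using q(1) by blast
  then obtain h where h: "\<And>i. i \<le> N \<Longrightarrow> h i \<in> mp_in K S" "\<And>i. i \<le> N \<Longrightarrow> q i = mp_subst (h i) H"
    by metis
  ultimately have sub0: "mp_subst (\<Sum>i\<le>N. mp_Const (e ^ i) * h i) H = 0"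
    by (simp add: mp_subst.sum mp_subst.mult)
  \<comment> \<open>Comparing coefficients at one monomial of f(H) writes e as a quotient of two
    elements of L.\<close>
  obtain \<alpha> where \<alpha>: "Poly_Mapping.lookup (mp_subst f H) \<alpha> \<noteq> 0"
    using nz by (metis lookup_zero poly_mapping_eqI)
  have in_L: "Poly_Mapping.lookup (mp_subst h H) \<alpha> \<in> L" if "h \<in> mp_in K {..<m}" for h
  proof -
    have "h \<in> mp_in L {..<m}" using that mp_in_mono[OF KL subset_refl] by blast
    then have "mp_subst h H \<in> mp_in L {..<n}"
      using good by (intro mp_subst_in[OF Lr]) (auto simp: same_trdeg_def)
    then show ?thesis by (simp add: mp_in_def mp_coeffs_in_def)
  qed
  have "e = Poly_Mapping.lookup (mp_subst g H) \<alpha> / Poly_Mapping.lookup (mp_subst f H) \<alpha>"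
    using \<alpha> by (simp add: eq[symmetric] lookup_mp_Const_mult)
  then have eL: "e \<in> L"
    using subfield_divide[OF L in_L[OF g] in_L[OF f]] by simp
  \<comment> \<open>The powers of e are only known to lie in L, so it is the independence over L
    that makes this polynomial vanish.\<close>
  have "(\<Sum>i\<le>N. mp_Const (e ^ i) * h i) \<in> mp_in L S"
  proof (intro subring_sum[OF mp_in_subring[OF Lr]] subring_mult[OF mp_in_subring[OF Lr]])
    fix i assume "i \<in> {..N}"
    then show "h i \<in> mp_in L S" using h(1) mp_in_mono[OF KL subset_refl] by auto
    show "mp_Const (e ^ i) \<in> mp_in L S"
      using eL by (intro mp_Const_in Lr subring_power[OF Lr])
  qed
  then have sum0: "(\<Sum>i\<le>N. mp_Const (e ^ i) * h i) = 0"
    using sub0 good by (simp add: same_trdeg_def alg_indep_iff)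
  obtain i0 where i0: "i0 \<le> N" "q i0 \<noteq> 0" using q(2) by blast
  then have "h i0 \<noteq> 0" using h(2) by auto
  then obtain \<beta> where \<beta>: "Poly_Mapping.lookup (h i0) \<beta> \<noteq> 0"
    by (metis lookup_zero poly_mapping_eqI)
  \<comment> \<open>The value r(e) is the coefficient at \<open>\<beta>\<close> of the vanishing
    polynomial; \<open>\<beta>\<close> is a monomial of some nonzero \<open>h i0\<close>, which
    makes r nonzero.\<close>
  define r where "r = (\<Sum>i\<le>N. monom (Poly_Mapping.lookup (h i) \<beta>) i)"
  have coeff_r: "coeff r i = (if i \<le> N then Poly_Mapping.lookup (h i) \<beta> else 0)" for i
    by (simp add: r_def coeff_sum)
  have "coeff r i0 \<noteq> 0" using i0 \<beta> by (simp add: coeff_r)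
  then have "r \<noteq> 0" by auto
  moreover have "coeff r i \<in> K" for i
    using h(1)[of i] by (auto simp: coeff_r subring_0[OF Kr] mp_in_def mp_coeffs_in_def)
  moreover have "poly r e = Poly_Mapping.lookup (\<Sum>i\<le>N. mp_Const (e ^ i) * h i) \<beta>"
    by (simp add: r_def poly_sum poly_monom lookup_sum lookup_mp_Const_mult) (simp only: mult.commute)
  ultimately have "algebraic_over K e"
    using sum0 unfolding algebraic_over_def by (intro exI[of _ r]) simp
  then show ?thesis using closed eL by (simp add: alg_closed_in_def)
qed

section \<open>Doubling of the variables\<close>

abbreviation (input) shift_vars :: "nat \<Rightarrow> 'a mpoly \<Rightarrow> 'a mpoly" where
  "shift_vars k f \<equiv> mp_subst f (\<lambda>i. mp_Var (i + k))"

text \<open>The pair (H(x), H(x')), where x' stands for the variables with indices from n to 2n -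
  1.\<close>

definition double :: "nat \<Rightarrow> 'a mpoly" where
  "double j = (if j < m then H j else shift_vars n (H (j - m)))"

text \<open>Evaluates the fresh variables at a point and keeps the original ones.\<close>

definition specialise :: "(nat \<Rightarrow> nat) \<Rightarrow> nat \<Rightarrow> 'a mpoly" where
  "specialise a i = (if i < n then mp_Var i else mp_Const (of_nat (a (i - n))))"

lemma H_in: "j < m \<Longrightarrow> H j \<in> mp_in L {..<n}"
  using good by (simp add: same_trdeg_def)

lemma specialise_id:
  assumes "mp_vars_in {..<n} f"
  shows "mp_subst f (specialise a) = f"
proof -
  have "mp_subst f (specialise a) = mp_subst f mp_Var"
    using assms by (rule mp_subst_cong) (simp add: specialise_def)
  then show ?thesis by (simp add: mp_subst_Var_id)
qed

lemma specialise_shift: "mp_subst (shift_vars n f) (specialise a) = mp_subst f (mp_point a)"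
  by (simp add: mp_subst_comp specialise_def)

lemma subst_double:
  assumes "mp_vars_in {..<m} f"
  shows "mp_subst f double = mp_subst f H"
  using assms by (rule mp_subst_cong) (simp add: double_def)

lemma subst_double_shift: "mp_subst (shift_vars m f) double = shift_vars n (mp_subst f H)"
  by (simp add: mp_subst_comp double_def)

lemma double_in:
  assumes "j < 2 * m"
  shows "double j \<in> mp_in L {..<2 * n}"
proof (cases "j < m")
  case True
  then show ?thesis
    using H_in[OF True] mp_in_mono[OF subset_refl, of "{..<n}" "{..<2 * n}"] by (auto simp: double_def)
next
  case False
  have "shift_vars n (H (j - m)) \<in> mp_in L {..<2 * n}"
    using assms False by (intro mp_subst_in[OF Lr H_in] mp_Var_in[OF Lr]) auto
  then show ?thesis using False by (simp add: double_def)
qed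

text \<open>Independence is applied once to each copy, the other copy being specialised at natural
  points. In this way a relation f(H, H') = 0 yields first f(y, H(a)) = 0 for all points a, then
  f(b, y') = 0 for a point b with f(b) nonzero.\<close>

lemma alg_indep_double: "alg_indep L double (S \<union> (\<lambda>i. i + m) ` S)"
  unfolding alg_indep_iff
proof (intro ballI impI)
  fix f assume f: "f \<in> mp_in L (S \<union> (\<lambda>i. i + m) ` S)" and f0: "mp_subst f double = 0"
  have Sm: "S \<subseteq> {..<m}" and indep: "\<And>f. f \<in> mp_in L S \<Longrightarrow> mp_subst f H = 0 \<Longrightarrow> f = 0"
    using good by (auto simp: same_trdeg_def alg_indep_iff)
  have vars_f: "mp_vars_in (S \<union> (\<lambda>i. i + m) ` S) f"
    using f by (simp add: mp_in_def)
  show "f = 0"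
  proof (rule ccontr)
    assume "f \<noteq> 0"
    then obtain b where b: "mp_subst f (mp_point b) \<noteq> 0"
      using mp_nonzero_at_nat_point by blast
    \<comment> \<open>The second copy of the variables is set to the point a in f(H, H') = 0; the
      result is a relation of H_S over L.\<close>
    have first: "mp_subst f (\<lambda>j. if j < m then mp_Var j else mp_subst (H (j - m)) (mp_point a)) = 0"
      (is "?g = 0") for a
    proof (rule indep)
      show "?g \<in> mp_in L S"
      proof (rule mp_subst_in[OF Lr f])
        fix j assume j: "j \<in> S \<union> (\<lambda>i. i + m) ` S"
        have "mp_subst (H (j - m)) (mp_point a) \<in> mp_in L S" if "\<not> j < m"
          using that j Sm
          by (intro mp_subst_in[OF Lr H_in] mp_Const_in[OF Lr] subring_of_nat[OF Lr]) auto
        then show "(if j < m then mp_Var j else mp_subst (H (j - m)) (mp_point a)) \<in> mp_in L S"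
          using j mp_Var_in[OF Lr] by auto
      qed
      have "mp_subst ?g H = mp_subst f (\<lambda>j. mp_subst (double j) (specialise a))"
        unfolding mp_subst_comp
        using vars_f
      proof (rule mp_subst_cong)
        fix j assume j: "j \<in> S \<union> (\<lambda>i. i + m) ` S"
        show "mp_subst (if j < m then mp_Var j else mp_subst (H (j - m)) (mp_point a)) H =
            mp_subst (double j) (specialise a)"
          using H_in[of j] by (auto simp: double_def specialise_shift mp_in_def specialise_id
              mp_subst_comp[of _ "mp_point a"])
      qed
      also have "\<dots> = 0" by (simp add: f0 flip: mp_subst_comp)
      finally show "mp_subst ?g H = 0" .
    qed
    \<comment> \<open>By \<open>first\<close>, f(b, H) vanishes at every natural point, hence
      identically.\<close>
    have "mp_subst f (\<lambda>j. if j < m then mp_Const (of_nat (b j)) else H (j - m)) = 0" (is "?h = 0")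
    proof (rule ccontr)
      assume "?h \<noteq> 0"
      then obtain a where a: "mp_subst ?h (mp_point a) \<noteq> 0"
        using mp_nonzero_at_nat_point by blast
      have "mp_subst ?h (mp_point a) = mp_subst
          (mp_subst f (\<lambda>j. if j < m then mp_Var j else mp_subst (H (j - m)) (mp_point a))) (mp_point b)"
        unfolding mp_subst_comp by (rule mp_subst_cong[OF vars_f]) (simp add: mp_subst_comp)
      then show False using a first by simp
    qed
    moreover have "?h = mp_subst
        (mp_subst f (\<lambda>j. if j < m then mp_Const (of_nat (b j)) else mp_Var (j - m))) H"
      unfolding mp_subst_comp by (rule mp_subst_cong[OF vars_f]) simp
    moreover have "mp_subst f (\<lambda>j. if j < m then mp_Const (of_nat (b j)) else mp_Var (j - m)) \<in> mp_in L S"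
      using Sm by (intro mp_subst_in[OF Lr f])
        (auto intro: mp_Const_in[OF Lr] subring_of_nat[OF Lr] mp_Var_in[OF Lr])
    ultimately have
      "mp_subst f (\<lambda>j. if j < m then mp_Const (of_nat (b j)) else mp_Var (j - m)) = 0" (is "?k = 0")
      using indep by simp
    moreover have "mp_subst f (mp_point b) = mp_subst ?k (\<lambda>i. mp_Const (of_nat (b (i + m))))"
      unfolding mp_subst_comp by (rule mp_subst_cong[OF vars_f]) simp
    ultimately show False using b by simp
  qed
qed

text \<open>Maximality is checked in each block separately: a relation of H over K is also one of
  the first copy, and with shifted variables one of the second.\<close>

lemma same_trdeg_double: "same_trdeg double (2 * n) (2 * m) (S \<union> (\<lambda>i. i + m) ` S)"
  (is "same_trdeg _ _ _ ?S")
  unfolding same_trdeg_def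
proof (intro conjI allI impI)
  show "?S \<subseteq> {..<2 * m}" using good by (force simp: same_trdeg_def)
next
  fix j assume j: "j < 2 * m" "j \<notin> ?S"
  have Sm: "S \<subseteq> {..<m}" using good by (simp add: same_trdeg_def)
  \<comment> \<open>The position of \<open>j\<close> within its own copy of
    \<open>H\<close>.\<close>
  define k where "k = (if j < m then j else j - m)"
  have "k \<notin> S"
  proof
    assume "k \<in> S"
    then have "j < m \<or> j \<in> (\<lambda>i. i + m) ` S"
      unfolding k_def by (cases "j < m") (auto intro!: image_eqI[of _ _ "j - m"])
    then show False using j \<open>k \<in> S\<close> by (auto simp: k_def)
  qed
  moreover have "k < m" using j by (auto simp: k_def)
  ultimately have k: "k < m" "k \<notin> S" by auto
  then obtain f where f: "f \<in> mp_in K (insert k S)" "mp_subst f H = 0" "f \<noteq> 0"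
    using good by (auto simp: same_trdeg_def alg_indep_iff)
  show "\<not> alg_indep K double (insert j ?S)"
  proof (cases "j < m")
    case True
    have "mp_vars_in {..<m} f"
      using f(1) Sm k mp_in_mono[OF subset_refl, of "insert k S" "{..<m}"] by (auto simp: mp_in_def)
    then have "mp_subst f double = 0" using f subst_double by simp
    moreover have "f \<in> mp_in K (insert j ?S)"
      using f(1) True mp_in_mono[OF subset_refl, of "insert k S" "insert j ?S"]
      by (auto simp: k_def)
    ultimately show ?thesis using f(3) unfolding alg_indep_iff by blast
  next
    case False
    have "mp_subst (shift_vars m f) (\<lambda>i. mp_Var (i - m)) = f"
      by (simp add: mp_subst_comp mp_subst_Var_id)
    then have "shift_vars m f \<noteq> 0" using f(3) by auto
    moreover have "shift_vars m f \<in> mp_in K (insert j ?S)"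
      using False by (intro mp_subst_in[OF Kr f(1)] mp_Var_in[OF Kr]) (auto simp: k_def)
    moreover have "mp_subst (shift_vars m f) double = 0"
      using f(2) by (simp add: subst_double_shift)
    ultimately show ?thesis unfolding alg_indep_iff by blast
  qed
qed (simp_all add: double_in alg_indep_double)

end

text \<open>Indexed families are used so that the notion covers both a given sequence of scalars
  and, with the identity map, a set of field elements.\<close>

definition lin_indep :: "'i set \<Rightarrow> ('i \<Rightarrow> 'a) \<Rightarrow> bool" where
  "lin_indep I lam \<longleftrightarrow>
     (\<forall>c. (\<forall>i\<in>I. c i \<in> K) \<and> (\<Sum>i\<in>I. c i * lam i) = 0 \<longrightarrow> (\<forall>i\<in>I. c i = 0))"

lemma lin_indep_mono:
  assumes "lin_indep I lam" "J \<subseteq> I" "finite I"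
  shows "lin_indep J lam"
  unfolding lin_indep_def
proof (intro allI impI ballI; elim conjE)
  fix c j assume c: "\<forall>i\<in>J. c i \<in> K" "(\<Sum>i\<in>J. c i * lam i) = 0" and j: "j \<in> J"
  define d where "d i = (if i \<in> J then c i else 0)" for i
  have "(\<Sum>i\<in>I. d i * lam i) = (\<Sum>i\<in>J. c i * lam i)"
    using assms by (intro sum.mono_neutral_cong_right) (auto simp: d_def)
  moreover have "\<forall>i\<in>I. d i \<in> K" using c by (simp add: d_def subring_0[OF Kr])
  ultimately have "d j = 0"
    using assms j c unfolding lin_indep_def by auto
  then show "c j = 0" using j by (simp add: d_def)
qed

text \<open>The induction runs over all tuples \<open>H\<close> at once, because its hypothesis is
  applied to the doubled tuple. The scalars stay fixed and may be any elements of the ambient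
  field.\<close>

theorem linearly_disjoint:
  assumes "finite I" and "same_trdeg H n m S" and "\<And>i. i \<in> I \<Longrightarrow> g i \<in> mp_in K {..<m}"
    and "lin_indep I lam" and "(\<Sum>i\<in>I. mp_Const (lam i) * mp_subst (g i) H) = 0"
  shows "\<forall>i\<in>I. mp_subst (g i) H = 0"
  using assms
proof (induction I arbitrary: H n m S g rule: finite_induct)
  case empty
  then show ?case by simp
next
  case (insert i0 I)
  note good = insert.prems(1)
  have indep: "lin_indep I lam"
    using lin_indep_mono[OF insert.prems(3)] insert.hyps by auto
  have g0: "g i0 \<in> mp_in K {..<m}" and g: "\<And>i. i \<in> I \<Longrightarrow> g i \<in> mp_in K {..<m}"
    using insert.prems(2) by auto
  let ?G = "\<lambda>i. mp_subst (g i) H"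
  have sum0: "mp_Const (lam i0) * ?G i0 + (\<Sum>i\<in>I. mp_Const (lam i) * ?G i) = 0"
    using insert.prems(4) insert.hyps by simp
  show ?case
  proof (cases "?G i0 = 0")
    case True
    then have "\<forall>i\<in>I. ?G i = 0"
      using sum0 by (intro insert.IH[OF good g indep]) auto
    then show ?thesis using True by simp
  next
    case False
    let ?\<sigma> = "\<lambda>k f. mp_subst f (\<lambda>i. mp_Var (i + k)) :: 'a mpoly"
    \<comment> \<open>On the doubled tuple these are antisymmetrised products; the one for
      \<open>i0\<close> would be 0, so the relation passes to them with one term fewer.\<close>
    define h where "h i = g i * ?\<sigma> m (g i0) - g i0 * ?\<sigma> m (g i)" for i
    have h_in: "h i \<in> mp_in K {..<2 * m}" if "i \<in> I" for i
    proof -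
      have "\<And>f. f \<in> mp_in K {..<m} \<Longrightarrow> ?\<sigma> m f \<in> mp_in K {..<2 * m}"
        by (intro mp_subst_in[OF Kr] mp_Var_in[OF Kr]) auto
      moreover have "mp_in K {..<m} \<subseteq> mp_in K {..<2 * m}"
        by (rule mp_in_mono) auto
      ultimately show ?thesis
        unfolding h_def using g[OF that] g0
        by (intro subring_diff[OF mp_in_subring[OF Kr]] subring_mult[OF mp_in_subring[OF Kr]]) auto
    qed
    have h_val: "mp_subst (h i) (double H n m) = ?G i * ?\<sigma> n (?G i0) - ?G i0 * ?\<sigma> n (?G i)"
      if "i \<in> I" for i
      using g[OF that] g0
      by (simp add: h_def mp_subst.diff mp_subst.mult subst_double_shift[OF good]
          subst_double[OF good] mp_in_def)
    have "\<forall>i\<in>I. mp_subst (h i) (double H n m) = 0"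
    proof (rule insert.IH[OF same_trdeg_double[OF good] h_in indep])
      have tail: "(\<Sum>i\<in>I. mp_Const (lam i) * ?G i) = - (mp_Const (lam i0) * ?G i0)"
        using sum0 by (simp add: eq_neg_iff_add_eq_0 add.commute)
      have "(\<Sum>i\<in>I. mp_Const (lam i) * mp_subst (h i) (double H n m)) =
          (\<Sum>i\<in>I. mp_Const (lam i) * ?G i) * ?\<sigma> n (?G i0) -
          ?G i0 * ?\<sigma> n (\<Sum>i\<in>I. mp_Const (lam i) * ?G i)"
        by (simp add: h_val mp_subst.sum mp_subst.mult sum_distrib_left sum_distrib_right
            sum_subtractf algebra_simps)
      also have "\<dots> = 0"
        unfolding tail by (simp add: mp_subst.mult mp_subst.uminus)
      finally show "(\<Sum>i\<in>I. mp_Const (lam i) * mp_subst (h i) (double H n m)) = 0" .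
    qed
    then have cross: "?G i * ?\<sigma> n (?G i0) = ?G i0 * ?\<sigma> n (?G i)" if "i \<in> I" for i
      using that h_val by simp
    \<comment> \<open>Setting the second copy of the variables to a in \<open>cross\<close> leaves
      G_i G_i0(a) = G_i0 G_i(a), so \<open>k i\<close> is the ratio of the two values at a.\<close>
    obtain a where a: "mp_subst (?G i0) (mp_point a) \<noteq> 0"
      using mp_nonzero_at_nat_point[OF False] by blast
    have "\<forall>f :: 'a mpoly. \<exists>c. mp_subst f (mp_point a) = mp_Const c"
      using mp_subst_point[OF UNIV_subring mp_in_UNIV] by metis
    then obtain ev where ev: "\<And>f :: 'a mpoly. mp_subst f (mp_point a) = mp_Const (ev f)" by metis
    have G_vars: "mp_vars_in {..<n} (?G i)" if "i \<in> insert i0 I" for i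
    proof -
      have "g i \<in> mp_in L {..<m}"
        using insert.prems(2)[OF that] mp_in_mono[OF KL subset_refl] by blast
      then have "?G i \<in> mp_in L {..<n}"
        using good by (intro mp_subst_in[OF Lr]) (auto simp: same_trdeg_def)
      then show ?thesis by (simp add: mp_in_def)
    qed
    define k where "k i = ev (?G i) / ev (?G i0)" for i
    have ev0: "ev (?G i0) \<noteq> 0" using a ev by simp
    have proportional: "mp_Const (k i) * ?G i0 = ?G i" if i: "i \<in> I" for i
    proof -
      have "mp_subst (?G i * ?\<sigma> n (?G i0)) (specialise n a) = mp_subst (?G i0 * ?\<sigma> n (?G i)) (specialise n a)"
        by (simp add: cross i)
      then have "?G i * mp_Const (ev (?G i0)) = ?G i0 * mp_Const (ev (?G i))"
        using G_vars i by (simp add: mp_subst.mult specialise_id[OF good] specialise_shift[OF good] ev)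
      then have "mp_Const (1 / ev (?G i0)) * (?G i * mp_Const (ev (?G i0))) =
          mp_Const (1 / ev (?G i0)) * (?G i0 * mp_Const (ev (?G i)))" by simp
      then show ?thesis
        using ev0 by (simp add: k_def mult_ac flip: mp_Const.mult)
    qed
    have kK: "k i \<in> K" if "i \<in> I" for i
      using ratio_in_K[OF good g0 g[OF that] False proportional[OF that]] .
    \<comment> \<open>Dividing the relation by G_i0 leaves a relation of the scalars whose
      coefficient at \<open>i0\<close> is 1.\<close>
    define c where "c i = (if i = i0 then 1 else k i)" for i
    have "mp_Const (lam i0 + (\<Sum>i\<in>I. k i * lam i)) * ?G i0 =
        mp_Const (lam i0) * ?G i0 + (\<Sum>i\<in>I. mp_Const (lam i) * ?G i)"
      by (simp add: mp_Const.add mp_Const.sum mp_Const.mult distrib_right sum_distrib_left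
          algebra_simps flip: proportional)
    then have "lam i0 + (\<Sum>i\<in>I. k i * lam i) = 0"
      using sum0 False by simp
    moreover have "(\<Sum>i\<in>I. c i * lam i) = (\<Sum>i\<in>I. k i * lam i)"
      using insert.hyps by (intro sum.cong) (auto simp: c_def)
    ultimately have "(\<Sum>i\<in>insert i0 I. c i * lam i) = 0"
      using insert.hyps by (simp add: c_def[of i0])
    moreover have "\<forall>i\<in>insert i0 I. c i \<in> K"
      using kK by (simp add: c_def subring_1[OF Kr])
    ultimately have "c i0 = 0"
      using insert.prems(3) unfolding lin_indep_def by blast
    then show ?thesis by (simp add: c_def)
  qed
qed

end

section \<open>Restriction to a line\<close>

interpretation const_poly: unital_hom "\<lambda>c. [:mp_Const c:]"
  by unfold_locales (simp_all add: mp_Const.add mp_Const.mult)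

text \<open>This is f(H + tv) with t as the variable of a univariate polynomial, so that
  \<open>coeff\<close> and \<open>pderiv\<close> give access to its Taylor coefficients.\<close>

definition mp_line :: "(nat \<Rightarrow> 'a mpoly) \<Rightarrow> (nat \<Rightarrow> 'a) \<Rightarrow> 'a::comm_ring_1 mpoly \<Rightarrow> 'a mpoly poly" where
  "mp_line H v = mp_eval (\<lambda>c. [:mp_Const c:]) (\<lambda>j. [:H j, mp_Const (v j):])"

interpretation mp_line: unital_hom "mp_line H v" for H :: "nat \<Rightarrow> 'a::comm_ring_1 mpoly" and v
  unfolding mp_line_def by (rule const_poly.mp_eval_unital_hom)

lemma mp_line_Const [simp]: "mp_line H v (mp_Const c) = [:mp_Const c:]"
  by (simp add: mp_line_def const_poly.mp_eval_Const)

lemma mp_line_Var [simp]: "mp_line H v (mp_Var j) = [:H j, mp_Const (v j):]"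
  by (simp add: mp_line_def const_poly.mp_eval_Var)

lemma poly_mp_line: "poly (mp_line H v f) x = mp_subst f (\<lambda>j. H j + mp_Const (v j) * x)"
  using UNIV_subring mp_in_UNIV[of f]
  by (induction f rule: mp_in_induct)
    (simp_all add: mp_line.add mp_line.mult mp_subst.add mp_subst.mult mult.commute)

lemma coeff_0_mp_line: "coeff (mp_line H v f) 0 = mp_subst f H"
  using poly_mp_line[of H v f 0] by (simp add: poly_0_coeff_0)

text \<open>As the linear coefficient of f(x + tv), the derivative inherits its rules from the
  homomorphism \<open>mp_line\<close>.\<close>

definition dir_deriv :: "(nat \<Rightarrow> 'a) \<Rightarrow> 'a::comm_ring_1 mpoly \<Rightarrow> 'a mpoly" where
  "dir_deriv v f = coeff (mp_line mp_Var v f) 1"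

lemma dir_deriv_Const [simp]: "dir_deriv v (mp_Const c) = 0"
  by (simp add: dir_deriv_def)

lemma dir_deriv_Var [simp]: "dir_deriv v (mp_Var j) = mp_Const (v j)"
  by (simp add: dir_deriv_def)

lemma dir_deriv_add: "dir_deriv v (f + g) = dir_deriv v f + dir_deriv v g"
  by (simp add: dir_deriv_def mp_line.add)

lemma dir_deriv_mult: "dir_deriv v (f * g) = f * dir_deriv v g + dir_deriv v f * g"
  by (simp add: dir_deriv_def mp_line.mult coeff_mult coeff_0_mp_line mp_subst_Var_id)

text \<open>The chain rule along a line: both sides obey the same product rule and agree on
  constants and variables.\<close>

lemma pderiv_mp_line:
  fixes f :: "'a::idom mpoly"
  shows "pderiv (mp_line H v f) = mp_line H v (dir_deriv v f)"
  using UNIV_subring mp_in_UNIV[of f]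
  by (induction f rule: mp_in_induct)
    (simp_all add: dir_deriv_add dir_deriv_mult mp_line.add mp_line.mult pderiv_add pderiv_mult
      pderiv_pCons algebra_simps)

lemma coeff_1_mp_line:
  fixes f :: "'a::idom mpoly"
  shows "coeff (mp_line H v f) 1 = mp_subst (dir_deriv v f) H"
  using coeff_pderiv[of "mp_line H v f" 0] by (simp add: pderiv_mp_line coeff_0_mp_line)

lemma dir_deriv_in:
  assumes F: "is_subring F" and f: "f \<in> mp_in F V" and v: "\<And>j. j \<in> V \<Longrightarrow> v j \<in> F"
  shows "dir_deriv v f \<in> mp_in F V"
  using F f
  by (induction f rule: mp_in_induct)
    (simp_all add: dir_deriv_add dir_deriv_mult v mp_Const_in[OF F]
      subring_closed[OF mp_in_subring[OF F]])

lemma dir_deriv_linear: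
  assumes F: "is_subring F" and f: "f \<in> mp_in F V"
    and v: "\<And>j. j \<in> V \<Longrightarrow> v j = (\<Sum>i\<in>I. lam i * u i j)"
  shows "dir_deriv v f = (\<Sum>i\<in>I. mp_Const (lam i) * dir_deriv (u i) f)"
  using F f
  by (induction f rule: mp_in_induct)
    (simp_all add: dir_deriv_add dir_deriv_mult v mp_Const.sum mp_Const.mult sum.distrib
      sum_distrib_left sum_distrib_right algebra_simps)

text \<open>This links the univariate form with \<open>proj_image_apex\<close>, where t is the
  variable x_n. Setting t to x_n gives one direction; for the other, each natural value of x_n gives
  a root, and a nonzero polynomial has only finitely many.\<close>

lemma mp_line_eq_0_iff:
  fixes H :: "nat \<Rightarrow> 'a::field_char_0 mpoly"
  assumes f: "mp_vars_in V f" and H: "\<And>j. j \<in> V \<Longrightarrow> mp_vars_in {..<n} (H j)"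
  shows "mp_line H v f = 0 \<longleftrightarrow> mp_subst f (\<lambda>j. H j + mp_Const (v j) * mp_Var n) = 0"
    (is "_ \<longleftrightarrow> ?s = 0")
proof
  assume "mp_line H v f = 0"
  then show "?s = 0" using poly_mp_line[of H v f "mp_Var n"] by simp
next
  assume s: "?s = 0"
  have root: "poly (mp_line H v f) (mp_Const (of_nat k)) = 0" for k
  proof -
    \<comment> \<open>Specialising x_n does not change the components of \<open>H\<close>, which do
      not involve it.\<close>
    let ?G = "\<lambda>i. if i = n then mp_Const (of_nat k) else mp_Var i :: 'a mpoly"
    have "poly (mp_line H v f) (mp_Const (of_nat k)) = mp_subst ?s ?G"
      unfolding poly_mp_line mp_subst_comp
    proof (rule mp_subst_cong[OF f])
      fix j assume "j \<in> V"
      then have "mp_subst (H j) ?G = mp_subst (H j) mp_Var"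
        using H by (intro mp_subst_cong) auto
      then show "H j + mp_Const (v j) * mp_Const (of_nat k) =
          mp_subst (H j + mp_Const (v j) * mp_Var n) ?G"
        by (simp add: mp_subst_Var_id mp_subst.add mp_subst.mult)
    qed
    then show ?thesis by (simp add: s)
  qed
  show "mp_line H v f = 0"
  proof (rule ccontr)
    assume "mp_line H v f \<noteq> 0"
    then have "finite {x. poly (mp_line H v f) x = 0}" by (rule poly_roots_finite)
    moreover have "range (\<lambda>k. mp_Const (of_nat k)) \<subseteq> {x. poly (mp_line H v f) x = 0}"
      using root by auto
    ultimately show False using infinite_const_of_nat finite_subset by blast
  qed
qed

text \<open>Up to the factor k!, invertible in characteristic zero, the k-th coefficient is the
  k-fold derivative of f evaluated at H, and that derivative is still in \<open>J\<close>.\<close>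

lemma mp_line_eq_0_of_invariant:
  fixes H :: "nat \<Rightarrow> 'a::field_char_0 mpoly"
  assumes "f \<in> J" and van: "\<And>f. f \<in> J \<Longrightarrow> mp_subst f H = 0"
    and inv: "\<And>f. f \<in> J \<Longrightarrow> dir_deriv v f \<in> J"
  shows "mp_line H v f = 0"
proof -
  have "coeff (mp_line H v f) k = 0" if "f \<in> J" for f k
    using that
  proof (induction k arbitrary: f)
    case 0
    then show ?case by (simp add: coeff_0_mp_line van)
  next
    case (Suc k)
    have "of_nat (Suc k) * coeff (mp_line H v f) (Suc k) = coeff (mp_line H v (dir_deriv v f)) k"
      by (simp add: coeff_pderiv flip: pderiv_mp_line)
    also have "\<dots> = 0" using Suc inv by blast
    finally show ?case
      by (simp del: of_nat_Suc)
  qed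
  then show ?thesis using assms(1) by (intro poly_eqI) simp
qed

section \<open>Descent of relations to K\<close>

context alg_closed_extension
begin

lemma exists_lin_indep_span:
  assumes "finite C"
  shows "\<exists>B. finite B \<and> lin_indep B (\<lambda>b. b) \<and> C \<subseteq> lin_span K B"
  using assms
proof (induction C rule: finite_induct)
  case empty
  show ?case by (intro exI[of _ "{}"]) (simp add: lin_indep_def)
next
  case (insert x C)
  then obtain B where B: "finite B" "lin_indep B (\<lambda>b. b)" "C \<subseteq> lin_span K B" by blast
  show ?case
  proof (cases "x \<in> lin_span K B")
    case True
    then show ?thesis using B by blast
  next
    case False
    have xB: "x \<notin> B" using False lin_span_base[OF Kr B(1)] by blast
    have "lin_indep (insert x B) (\<lambda>b. b)"
      unfolding lin_indep_def
    proof (intro allI impI; elim conjE)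
      fix c assume c: "\<forall>b\<in>insert x B. c b \<in> K" "(\<Sum>b\<in>insert x B. c b * b) = 0"
      have s: "c x * x + (\<Sum>b\<in>B. c b * b) = 0" using c(2) B(1) xB by simp
      have "c x = 0"
      proof (rule ccontr)
        assume nz: "c x \<noteq> 0"
        have "x = (\<Sum>b\<in>B. (- c b / c x) * b)"
        proof -
          have "c x * x = - (\<Sum>b\<in>B. c b * b)" using s by (simp add: eq_neg_iff_add_eq_0)
          then have "x = - (\<Sum>b\<in>B. c b * b) / c x" using nz by (simp add: field_simps)
          then show ?thesis by (simp add: sum_negf sum_divide_distrib)
        qed
        moreover have "\<forall>b\<in>B. - c b / c x \<in> K"
          using c(1) subfield_divide[OF K] subring_uminus[OF Kr] by simp
        ultimately have "x \<in> lin_span K B"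
          unfolding lin_span_def mem_Collect_eq by (intro exI[of _ "\<lambda>b. - c b / c x"] conjI)
        then show False using False by blast
      qed
      then show "\<forall>b\<in>insert x B. c b = 0"
        using B(2) s c(1) by (auto simp: lin_indep_def)
    qed
    moreover have "lin_span K B \<subseteq> lin_span K (insert x B)"
    proof
      fix z assume "z \<in> lin_span K B"
      then show "z \<in> lin_span K (insert x B)"
        using lin_span_mult[OF Kr, of B 1 "insert x B" z] lin_span_base[OF Kr, of "insert x B"] B(1)
        by simp
    qed
    ultimately show ?thesis
      using B lin_span_base[OF Kr, of "insert x B" x] by (intro exI[of _ "insert x B"]) auto
  qed
qed

text \<open>The coefficients of f span a finite-dimensional space over K; expanding them in a basis
  and collecting terms gives the \<open>g b\<close>. Disjointness then splits any relation of H into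
  relations over K.\<close>

lemma mp_decompose:
  assumes f: "mp_vars_in V f"
  obtains B g where "finite B" "lin_indep B (\<lambda>b. b)" "\<And>b. b \<in> B \<Longrightarrow> g b \<in> mp_in K V"
    "f = (\<Sum>b\<in>B. mp_Const b * g b)"
proof -
  let ?k = "Poly_Mapping.keys f"
  obtain B where B: "finite B" "lin_indep B (\<lambda>b. b)" "Poly_Mapping.lookup f ` ?k \<subseteq> lin_span K B"
    using exists_lin_indep_span[of "Poly_Mapping.lookup f ` ?k"] by auto
  have "\<forall>\<alpha>. \<exists>c. \<alpha> \<in> ?k \<longrightarrow> (\<forall>b\<in>B. c b \<in> K) \<and> Poly_Mapping.lookup f \<alpha> = (\<Sum>b\<in>B. c b * b)"
    using B(3) by (auto simp: lin_span_def)
  then obtain c where c: "\<And>\<alpha> b. \<alpha> \<in> ?k \<Longrightarrow> b \<in> B \<Longrightarrow> c \<alpha> b \<in> K"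
    "\<And>\<alpha>. \<alpha> \<in> ?k \<Longrightarrow> Poly_Mapping.lookup f \<alpha> = (\<Sum>b\<in>B. c \<alpha> b * b)"
    by metis
  define g where "g b = (\<Sum>\<alpha>\<in>?k. Poly_Mapping.single \<alpha> (c \<alpha> b))" for b
  have "g b \<in> mp_in K V" if "b \<in> B" for b
    unfolding g_def using c(1) that f
    by (intro subring_sum[OF mp_in_subring[OF Kr]] single_in_mp_in)
      (auto simp: mp_vars_in_def subring_0[OF Kr])
  moreover have "f = (\<Sum>b\<in>B. mp_Const b * g b)"
  proof (rule poly_mapping_eqI)
    fix \<beta>
    have "Poly_Mapping.lookup (g b) \<beta> = (if \<beta> \<in> ?k then c \<beta> b else 0)" for b
      by (simp add: g_def lookup_sum lookup_single when_def)
    then show "Poly_Mapping.lookup f \<beta> = Poly_Mapping.lookup (\<Sum>b\<in>B. mp_Const b * g b) \<beta>"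
      using c(2)[of \<beta>]
      by (cases "\<beta> \<in> ?k") (auto simp: lookup_sum lookup_mp_Const_mult in_keys_iff mult.commute)
  qed
  ultimately show ?thesis using that B by blast
qed

end

theorem theorem4p7:
  fixes K L Lt :: "'a::field_char_0 set"
    and n m r :: nat
    and H :: "nat \<Rightarrow> 'a mpoly"
    and p :: "nat \<Rightarrow> 'a"
    and lam :: "nat \<Rightarrow> 'a"
    and P :: "nat \<Rightarrow> nat \<Rightarrow> 'a"
  assumes K: "is_subfield K" and L: "is_subfield L" and Lt: "is_subfield Lt"
    and KL: "K \<subseteq> L" and LLt: "L \<subseteq> Lt"
    and Kclosed: "alg_closed_in K L"
    and H: "\<forall>j<m. mp_coeffs_in L (H j) \<and> mp_vars_in {..<n} (H j)"
    and tr: "trdeg K H m \<le> trdeg L H m"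
    and p_in: "\<forall>j<m. p j \<in> Lt"
    and apex: "proj_image_apex K n m H p"
    and P_in: "\<forall>i<r. \<forall>j<m. P i j \<in> K"
    and lam_in: "\<forall>i<r. lam i \<in> Lt"
    and lam_indep: "\<forall>c. (\<forall>i<r. c i \<in> K) \<and> (\<Sum>i<r. c i * lam i) = 0 \<longrightarrow> (\<forall>i<r. c i = 0)"
    and decomp: "\<forall>j<m. p j = (\<Sum>i<r. lam i * P i j)"
  shows "\<forall>i<r. (\<forall>j<m. P i j = 0) \<or> proj_image_apex Lt n m H (P i)"
proof -
  interpret alg_closed_extension K L
    using K L KL Kclosed by unfold_locales
  obtain S where good: "same_trdeg H n m S"
    using same_trdeg_exists[OF _ tr, of n] H by (auto simp: mp_in_def)
  \<comment> \<open>The relations of H over K; they are to be stable under differentiation in each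
    direction \<open>P i\<close>.\<close>
  define J where "J = {f \<in> mp_in K {..<m}. mp_subst f H = 0}"
  have line_iff: "mp_line H v f = 0 \<longleftrightarrow> mp_subst f (\<lambda>j. H j + mp_Const (v j) * mp_Var n) = 0"
    if "mp_vars_in {..<m} f" for v f
    using that H by (intro mp_line_eq_0_iff) auto
  have invariant: "dir_deriv (P i) f \<in> J" if i: "i < r" and f: "f \<in> J" for i f
  proof -
    have fK: "f \<in> mp_in K {..<m}" using f by (simp add: J_def)
    have D_in: "dir_deriv (P i) f \<in> mp_in K {..<m}" if "i < r" for i
      using that P_in by (intro dir_deriv_in[OF Kr fK]) auto
    have "mp_line H p f = 0"
      using apex f line_iff[of f p] by (auto simp: proj_image_apex_def J_def mp_in_def)
    \<comment> \<open>Of the apex property only the linear coefficient in t is used.\<close>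
    then have "mp_subst (dir_deriv p f) H = 0"
      by (simp flip: coeff_1_mp_line)
    moreover have "dir_deriv p f = (\<Sum>i<r. mp_Const (lam i) * dir_deriv (P i) f)"
      using decomp by (intro dir_deriv_linear[OF Kr fK]) auto
    ultimately have "(\<Sum>i<r. mp_Const (lam i) * mp_subst (dir_deriv (P i) f) H) = 0"
      by (simp add: mp_subst.sum mp_subst.mult)
    moreover have "lin_indep {..<r} lam"
      using lam_indep by (simp add: lin_indep_def Ball_def)
    ultimately have "\<forall>i\<in>{..<r}. mp_subst (dir_deriv (P i) f) H = 0"
      using D_in by (intro linearly_disjoint[OF _ good]) auto
    then show ?thesis using i D_in by (simp add: J_def)
  qed
  \<comment> \<open>The coefficients of f may lie anywhere in the ambient field, which includes
    those in \<open>Lt\<close>.\<close>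
  have line_0: "mp_line H (P i) f = 0"
    if i: "i < r" and f: "mp_vars_in {..<m} f" "mp_subst f H = 0" for i f
  proof -
    obtain B g where B: "finite B" "lin_indep B (\<lambda>b. b)" "\<And>b. b \<in> B \<Longrightarrow> g b \<in> mp_in K {..<m}"
      "f = (\<Sum>b\<in>B. mp_Const b * g b)"
      using mp_decompose[OF f(1)] by blast
    have "(\<Sum>b\<in>B. mp_Const b * mp_subst (g b) H) = 0"
      using f(2) by (simp add: B(4) mp_subst.sum mp_subst.mult)
    then have "\<forall>b\<in>B. mp_subst (g b) H = 0"
      using B(3) by (intro linearly_disjoint[OF B(1) good _ B(2)])
    then have "mp_line H (P i) (g b) = 0" if "b \<in> B" for b
      using that B(3) invariant[OF i]
      by (intro mp_line_eq_0_of_invariant[of _ J]) (auto simp: J_def)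
    then show ?thesis
      by (simp add: B(4) mp_line.sum mp_line.mult)
  qed
  show ?thesis
    using line_0 line_iff by (auto simp: proj_image_apex_def)
qed

end
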